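(* Let $\mathcal H$ be a hypothesis class over a domain $\mathcal X$. The following are equivalent: (i) $\mathcal H$ is in $\mathrm P$; (ii) for every finite $R\subseteq\mathcal X$ there is a protocol that decides the realizability problem for $\mathcal H|_R$ with sample complexity at most $c\log n$ for inputs of size $n$, where $c$ is a constant depending only on $\mathcal H$; (iii) for every finite $R\subseteq\mathcal X$ there is a protocol in Yao's model that decides the realizability problem for $\mathcal H|_R$ with bit complexity at most $c\log^m|R|$, where $c$ and $m$ are constants depending only on $\mathcal H$.
   Context: Communication model: $\mathcal Z=\mathcal X\times\{\pm1\}$ is the set of examples, a sample is a finite sequence of examples. Alice receives sample $S_a$, Bob receives $S_b$, joint sample $S=(S_a,S_b)$ of size $n$ (arbitrary split). A deterministic protocol proceeds by messages, each either a single example from the sender's own input sample or a bit, depending only on the sender's input and previous messages; output is determined by the messages; each example or bit costs one unit; sample complexity is the maximum number of units transmitted on inputs of size $n$. $S$ is realizable by $\mathcal H$ if some $h\in\mathcal H$ has $h(x)=y$ for all $(x,y)\in S$; the realizability problem is to decide this. $\mathcal H\in\mathrm P$ if some protocol decides the realizability problem for $\mathcal H$ with sample complexity $\mathrm{poly}(\log n)$. For $R\subseteq\mathcal X$, $\mathcal H|_R=\{h|_R:h\in\mathcal H\}$, whose realizability problem concerns samples with points in $R$. Yao's model: a protocol in which the parties exchange only bits (inputs being samples with points in $R$), and bit complexity is the number of bits exchanged. *)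

theory Defs
  imports Complex_Main
begin

text \<open>Examples are pairs (x, y) with label y :: bool encoding +1/-1; samples are lists of examples.
  A hypothesis class is a set of functions X to bool.\<close>

type_synonym 'x example = "'x \<times> bool"
type_synonym 'x sample = "'x example list"

definition realizable :: "('x \<Rightarrow> bool) set \<Rightarrow> 'x sample \<Rightarrow> bool" where
  "realizable H S \<longleftrightarrow> (\<exists>h\<in>H. \<forall>(x, y)\<in>set S. h x = y)"

datatype 'x msg = MBit bool | MEx "'x example"

text \<open>After a transcript (list of previous messages) the protocol either halts with an output,
  or designates the next sender (True = Alice, False = Bob).\<close>
datatype step = Output bool | Turn bool

type_synonym 'x protocol = "('x msg list \<Rightarrow> step) \<times> (bool \<Rightarrow> 'x sample \<Rightarrow> 'x msg list \<Rightarrow> 'x msg)"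

definition nxt :: "'x protocol \<Rightarrow> 'x msg list \<Rightarrow> step" where
  "nxt P t = fst P t"

definition say :: "'x protocol \<Rightarrow> bool \<Rightarrow> 'x sample \<Rightarrow> 'x msg list \<Rightarrow> 'x msg" where
  "say P p S t = snd P p S t"

fun run :: "'x protocol \<Rightarrow> 'x sample \<Rightarrow> 'x sample \<Rightarrow> nat \<Rightarrow> 'x msg list" where
  "run P Sa Sb 0 = []"
| "run P Sa Sb (Suc k) =
     (let t = run P Sa Sb k in
      case nxt P t of
        Output b \<Rightarrow> t
      | Turn p \<Rightarrow> t @ [say P p (if p then Sa else Sb) t])"

definition valid_transcript :: "'x protocol \<Rightarrow> 'x sample \<Rightarrow> 'x sample \<Rightarrow> 'x msg list \<Rightarrow> bool" where
  "valid_transcript P Sa Sb t \<longleftrightarrow>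
     (\<forall>i<length t. case nxt P (take i t) of
         Output _ \<Rightarrow> True
       | Turn p \<Rightarrow> (case t ! i of MBit _ \<Rightarrow> True
                              | MEx z \<Rightarrow> z \<in> set (if p then Sa else Sb)))"

text \<open>P decides the realizability problem for H restricted to R (inputs: samples with all points in R)
  with cost (number of messages = units) at most B n on inputs of joint size n:
  after floor(B n) rounds the protocol has halted with the correct answer, and all
  example messages were legal.\<close>
definition decides_within ::
  "'x protocol \<Rightarrow> ('x \<Rightarrow> bool) set \<Rightarrow> 'x set \<Rightarrow> (nat \<Rightarrow> real) \<Rightarrow> bool" where
  "decides_within P H R B \<longleftrightarrow>
     (\<forall>Sa Sb. fst ` set (Sa @ Sb) \<subseteq> R \<longrightarrow>
        (let t = run P Sa Sb (nat \<lfloor>B (length Sa + length Sb)\<rfloor>) in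
           nxt P t = Output (realizable H (Sa @ Sb)) \<and> valid_transcript P Sa Sb t))"

definition bits_only :: "'x protocol \<Rightarrow> bool" where
  "bits_only P \<longleftrightarrow> (\<forall>p S t. \<exists>b. say P p S t = MBit b)"

definition in_P :: "('x \<Rightarrow> bool) set \<Rightarrow> bool" where
  "in_P H \<longleftrightarrow> (\<exists>P (c::real) (m::nat). decides_within P H UNIV (\<lambda>n. c * (log 2 (real n + 2)) ^ m))"

end

theory Submission
  imports Defs "HOL-Library.FuncSet" "HOL-Real_Asymp.Real_Asymp"
begin

text \<open>
  Each of the three conditions holds iff the VC dimension and the coVC dimension of \<open>H\<close> (the least \<open>k\<close>
  such that every unrealizable sample has an unrealizable subsample of size at most \<open>k\<close>) are finite.

  If one of the dimensions is infinite, then \<open>H\<close> encodes set disjointness on arbitrarily large sets, on a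
  shattered set or on a minimal unrealizable sample \<open>Y\<close>. By the rectangle property the \<open>2 ^ card Y\<close>
  complementary inputs have different transcripts, whereas \<open>T\<close> rounds over \<open>O(card Y)\<close> possible messages
  allow only \<open>O(card Y) ^ T\<close> transcripts.

  If both are finite, the parties boost: each gives the weight \<open>2 ^ e\<close> to an example misclassified by
  \<open>e\<close> of the previous hypotheses, and sends an \<open>\<epsilon>\<close>-net of its own weighted sample, of size depending only
  on \<open>\<epsilon> = 1 / (4 * k)\<close> and the VC dimension. If the two nets are not jointly realizable, neither is the
  input; otherwise a hypothesis consistent with both is the next one. After \<open>O(k * log n)\<close> rounds every
  example is misclassified by a fraction of less than \<open>1 / k\<close> of the hypotheses, and then some hypothesis
  is correct on any given \<open>k\<close> examples, so that the input is realizable. This costs \<open>O(log n)\<close> units. For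
  Yao's model, remove duplicates and encode examples in binary.
\<close>

subsection \<open>Epsilon-nets\<close>

definition shatters :: "'a set set \<Rightarrow> 'a set \<Rightarrow> bool" where
  "shatters F Y \<longleftrightarrow> (\<forall>Z\<subseteq>Y. \<exists>A\<in>F. A \<inter> Y = Z)"

text \<open>Strict, so that \<open>d = 0\<close> describes exactly the empty family, the case in
  which the Sauer-Shelah recursion ends.\<close>

definition vc_less :: "'a set set \<Rightarrow> nat \<Rightarrow> bool" where
  "vc_less F d \<longleftrightarrow> (\<forall>Y. finite Y \<longrightarrow> shatters F Y \<longrightarrow> card Y < d)"

text \<open>A set shattered by \<open>P \<inter> Q\<close> stays shattered by \<open>F\<close> after
  adding \<open>x\<close>, so removing \<open>x\<close> reduces the count to two families on
  \<open>X\<close>, one with bound \<open>d\<close> and one with \<open>d - 1\<close>.\<close>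

lemma sauer_shelah:
  assumes "finite X" "F \<subseteq> Pow X" "vc_less F d"
  shows "card F \<le> (card X + 1) ^ d"
  using assms
proof (induction X arbitrary: F d rule: finite_induct)
  case empty
  then have "card F \<le> card {{} :: 'a set}" by (intro card_mono) auto
  then show ?case by simp
next
  case (insert x X)
  show ?case
  proof (cases d)
    case 0
    have "\<not> shatters F {}" using insert.prems(2) 0 by (auto simp: vc_less_def)
    then have "F = {}" by (auto simp: shatters_def)
    then show ?thesis by simp
  next
    case (Suc e)
    \<comment> \<open>\<open>P \<union> Q\<close> is the trace of \<open>F\<close> on
      \<open>X\<close>; \<open>P \<inter> Q\<close> collects the traces that extend in both ways and
      would otherwise be counted once only.\<close>
    define P where "P = {A \<in> F. x \<notin> A}"
    define Q where "Q = (\<lambda>A. A - {x}) ` {A \<in> F. x \<in> A}"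
    have finF: "finite F"
      using insert.prems(1) insert.hyps(1) by (meson finite.insertI finite_Pow_iff finite_subset)
    have "inj_on (\<lambda>A. A - {x}) {A \<in> F. x \<in> A}"
      by (auto simp: inj_on_def)
    then have cQ: "card Q = card {A \<in> F. x \<in> A}"
      unfolding Q_def by (rule card_image)
    have "F = P \<union> {A \<in> F. x \<in> A}" by (auto simp: P_def)
    then have "card F = card P + card {A \<in> F. x \<in> A}"
      using finF by (metis (no_types, lifting) P_def card_Un_disjoint disjoint_iff finite_Un mem_Collect_eq)
    also have "\<dots> = card (P \<union> Q) + card (P \<inter> Q)"
      unfolding cQ[symmetric] by (intro card_Un_Int) (use finF in \<open>auto simp: P_def Q_def\<close>)
    finally have split: "card F = card (P \<union> Q) + card (P \<inter> Q)" .
    have PQ: "P \<union> Q \<subseteq> Pow X" using insert.prems(1) by (auto simp: P_def Q_def)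
    have ins: "insert x A \<in> F" if "A \<in> Q" for A
      using that by (auto simp: Q_def insert_absorb)
    have v0: "vc_less (P \<union> Q) d"
      unfolding vc_less_def
    proof (intro allI impI)
      fix Y assume Y: "finite Y" "shatters (P \<union> Q) Y"
      have "Y \<subseteq> X" using Y(2) PQ by (fastforce simp: shatters_def)
      then have xY: "x \<notin> Y" using insert.hyps by auto
      have "shatters F Y" unfolding shatters_def
      proof (intro allI impI)
        fix Z assume "Z \<subseteq> Y"
        then obtain A where A: "A \<in> P \<union> Q" "A \<inter> Y = Z" using Y(2) by (auto simp: shatters_def)
        have "insert x A \<inter> Y = Z" using A(2) xY by auto
        then show "\<exists>A\<in>F. A \<inter> Y = Z" using A ins by (auto simp: P_def)
      qed
      then show "card Y < d" using insert.prems(2) Y(1) by (auto simp: vc_less_def)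
    qed
    have v1: "vc_less (P \<inter> Q) e"
      unfolding vc_less_def
    proof (intro allI impI)
      fix Y assume Y: "finite Y" "shatters (P \<inter> Q) Y"
      have "Y \<subseteq> X" using Y(2) PQ by (fastforce simp: shatters_def)
      then have xY: "x \<notin> Y" using insert.hyps by auto
      have "shatters F (insert x Y)" unfolding shatters_def
      proof (intro allI impI)
        fix Z assume Z: "Z \<subseteq> insert x Y"
        then have "Z - {x} \<subseteq> Y" by auto
        then obtain A where A: "A \<in> P \<inter> Q" "A \<inter> Y = Z - {x}" 
          using Y(2) unfolding shatters_def by blast
        have "x \<notin> A" using A(1) by (auto simp: P_def)
        then have "(if x \<in> Z then insert x A else A) \<inter> insert x Y = Z"
          using A(2) Z by auto
        moreover have "(if x \<in> Z then insert x A else A) \<in> F"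
          using A(1) ins by (auto simp: P_def)
        ultimately show "\<exists>A\<in>F. A \<inter> insert x Y = Z" by blast
      qed
      then have "card (insert x Y) < d" using insert.prems(2) Y(1) unfolding vc_less_def by blast
      then show "card Y < e" using xY Y(1) Suc by simp
    qed
    have "card F \<le> (card X + 1) ^ d + (card X + 1) ^ e"
      unfolding split using PQ insert.IH[OF _ v0] insert.IH[OF _ v1] by (intro add_mono) auto
    also have "\<dots> = (card X + 2) * (card X + 1) ^ e" using Suc by simp
    also have "\<dots> \<le> (card X + 2) * (card X + 2) ^ e" by (intro mult_left_mono power_mono) auto
    finally show ?thesis using insert.hyps Suc by simp
  qed
qed

text \<open>Some trace tells any two points of a shattered index set apart, so \<open>g\<close> is
  injective on it and its image is shattered by \<open>F\<close>.\<close>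

lemma vc_less_traces:
  assumes "vc_less F d"
  shows "vc_less ((\<lambda>A. {j \<in> J. g j \<in> A}) ` F) d"
  unfolding vc_less_def
proof (intro allI impI)
  fix Y assume Y: "finite Y" "shatters ((\<lambda>A. {j \<in> J. g j \<in> A}) ` F) Y"
  then have *: "\<exists>A\<in>F. {j \<in> J. g j \<in> A} \<inter> Y = Z" if "Z \<subseteq> Y" for Z
    using that by (auto simp: shatters_def)
  have YJ: "Y \<subseteq> J" using *[of Y] by auto
  have inj: "inj_on g Y"
  proof (rule inj_onI)
    fix a b assume ab: "a \<in> Y" "b \<in> Y" "g a = g b"
    obtain A where A: "{j \<in> J. g j \<in> A} \<inter> Y = {a}" using *[of "{a}"] ab by auto
    then have "g a \<in> A" by blast
    then have "b \<in> {j \<in> J. g j \<in> A} \<inter> Y" using ab YJ by auto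
    then show "a = b" unfolding A by simp
  qed
  have "shatters F (g ` Y)"
    unfolding shatters_def
  proof (intro allI impI)
    fix Z assume Z: "Z \<subseteq> g ` Y"
    obtain A where A: "A \<in> F" "{j \<in> J. g j \<in> A} \<inter> Y = {j \<in> Y. g j \<in> Z}"
      using *[of "{j \<in> Y. g j \<in> Z}"] by auto
    have "g j \<in> A \<longleftrightarrow> g j \<in> Z" if "j \<in> Y" for j
    proof -
      have "g j \<in> A \<longleftrightarrow> j \<in> {j \<in> J. g j \<in> A} \<inter> Y" using that YJ by auto
      then show ?thesis unfolding A(2) using that by simp
    qed
    then have "A \<inter> g ` Y = Z" using Z by auto
    then show "\<exists>A\<in>F. A \<inter> g ` Y = Z" using A(1) by blast
  qed
  then have "card (g ` Y) < d" using assms Y(1) by (auto simp: vc_less_def)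
  then show "card Y < d" using card_image[OF inj] by simp
qed

section \<open>Random tuples and symmetrization\<close>

lemma card_PiE_coord:
  assumes "finite I" "i < m"
  shows "card {y \<in> PiE {..<m} (\<lambda>_. I). y i \<in> B} = card (I \<inter> B) * card I ^ (m - 1)"
proof -
  have "{y \<in> PiE {..<m} (\<lambda>_. I). y i \<in> B} = PiE {..<m} (\<lambda>j. if j = i then I \<inter> B else I)"
    using assms(2) by (intro set_eqI) (simp add: PiE_iff, metis Int_iff lessThan_iff)
  also have "card \<dots> = (\<Prod>j<m. card (if j = i then I \<inter> B else I))"
    by (simp add: card_PiE)
  also have "\<dots> = card (I \<inter> B) * (\<Prod>j\<in>{..<m} - {i}. card (if j = i then I \<inter> B else I))"
    using assms(2) by (subst prod.remove[of _ i]) auto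
  also have "(\<Prod>j\<in>{..<m} - {i}. card (if j = i then I \<inter> B else I)) = (\<Prod>j\<in>{..<m} - {i}. card I)"
    by (rule prod.cong) auto
  finally show ?thesis using assms(2) by simp
qed

text \<open>Markov's inequality applied to the number of misses: the average number of hits is at least
  \<open>2 * K\<close> and never exceeds \<open>m = 2 * q * K\<close>.\<close>
lemma many_hitting_tuples:
  assumes I: "finite I" and q: "card I \<le> q * card (I \<inter> B)" and m: "m = 2 * q * K" and K: "K > 0"
    and q0: "q > 0"
  shows "card I ^ m \<le> 2 * q * card {y \<in> PiE {..<m} (\<lambda>_. I). K \<le> card {i\<in>{..<m}. y i \<in> B}}"
proof -
  have m0: "m > 0" using m K q0 by simp
  let ?T = "PiE {..<m} (\<lambda>_. I)"
  let ?G = "{y \<in> ?T. K \<le> card {i\<in>{..<m}. y i \<in> B}}"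
  have finT: "finite ?T" using I by (simp add: finite_PiE)
  have cT: "card ?T = card I ^ m" by (simp add: card_PiE)
  have "2 * K * card I ^ m = 2 * K * card I * card I ^ (m - 1)"
    using m0 by (metis mult.assoc power_minus_mult mult.commute)
  also have "\<dots> \<le> 2 * K * (q * card (I \<inter> B)) * card I ^ (m - 1)"
    using q by (intro mult_right_mono mult_left_mono) auto
  also have "\<dots> = (\<Sum>i<m. card {y \<in> ?T. y i \<in> B})"
    using card_PiE_coord[OF I, where m=m and B=B] by (simp add: m)
  also have "\<dots> = (\<Sum>i<m. \<Sum>y\<in>?T. of_bool (y i \<in> B))"
    using finT by (simp add: Int_def)
  also have "\<dots> = (\<Sum>y\<in>?T. \<Sum>i<m. of_bool (y i \<in> B))"
    by (rule sum.swap)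
  also have "\<dots> = (\<Sum>y\<in>?T. card {i\<in>{..<m}. y i \<in> B})"
    by (simp add: Int_def)
  \<comment> \<open>A tuple outside \<open>?G\<close> has fewer than \<open>K\<close> hits, a tuple
    in \<open>?G\<close> at most \<open>m\<close>.\<close>
  also have "\<dots> \<le> (\<Sum>y\<in>?T. K + m * of_bool (y \<in> ?G))"
  proof (rule sum_mono)
    fix y assume "y \<in> ?T"
    have "card {i\<in>{..<m}. y i \<in> B} \<le> card {..<m}" by (rule card_mono) auto
    then show "card {i\<in>{..<m}. y i \<in> B} \<le> K + m * of_bool (y \<in> ?G)"
      using \<open>y \<in> ?T\<close> by auto
  qed
  also have "\<dots> = K * card I ^ m + m * card ?G"
    using finT by (simp add: sum.distrib cT sum_distrib_left[symmetric] Int_def)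
  finally have "K * card I ^ m \<le> K * (2 * q * card ?G)" by (simp add: m algebra_simps)
  then show ?thesis using K by simp
qed

text \<open>The symmetrization of the double-sampling argument: each swap is an involution permuting
  the pairs of tuples.\<close>

definition swap :: "nat set \<Rightarrow> (nat \<Rightarrow> 'a) \<times> (nat \<Rightarrow> 'a) \<Rightarrow> (nat \<Rightarrow> 'a) \<times> (nat \<Rightarrow> 'a)" where
  "swap \<sigma> p = ((\<lambda>i. if i \<in> \<sigma> then snd p i else fst p i), (\<lambda>i. if i \<in> \<sigma> then fst p i else snd p i))"

lemma swap_swap: "swap \<sigma> (swap \<sigma> p) = p"
  by (auto simp: swap_def prod_eq_iff)

text \<open>A swap after which a range with trace \<open>T\<close> misses the first half is determined on every
  coordinate where it hits the second half.\<close>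
lemma card_good_swaps:
  fixes m K :: nat and T :: "(nat \<times> bool) set"
  assumes "K \<le> m"
  defines "G \<equiv> {\<sigma>. \<sigma> \<subseteq> {..<m} \<and> (\<forall>i<m. (i, i \<in> \<sigma>) \<notin> T) \<and> K \<le> card {i\<in>{..<m}. (i, i \<notin> \<sigma>) \<in> T}}"
  shows "card G \<le> 2 ^ (m - K)"
proof (cases "G = {}")
  case False
  then obtain \<tau> where \<tau>: "\<tau> \<in> G" by auto
  define D where "D = {i\<in>{..<m}. (i, i \<notin> \<tau>) \<in> T}"
  have agree: "i \<in> \<sigma> \<longleftrightarrow> i \<in> \<tau>" if "\<sigma> \<in> G" "i \<in> D" for \<sigma> i
  proof (rule ccontr)
    assume "\<not> ?thesis"
    then have "(i \<in> \<sigma>) = (i \<notin> \<tau>)" by blast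
    then have "(i, i \<in> \<sigma>) \<in> T" "i < m" using that(2) by (simp_all add: D_def)
    then show False using that(1) by (simp add: G_def)
  qed
  have "inj_on (\<lambda>\<sigma>. \<sigma> - D) G"
  proof (rule inj_onI)
    fix \<sigma> \<rho> assume "\<sigma> \<in> G" "\<rho> \<in> G" "\<sigma> - D = \<rho> - D"
    then show "\<sigma> = \<rho>" using agree by blast
  qed
  moreover have "(\<lambda>\<sigma>. \<sigma> - D) ` G \<subseteq> Pow ({..<m} - D)" by (auto simp: G_def)
  ultimately have "card G \<le> card (Pow ({..<m} - D))" by (intro card_inj_on_le) auto
  also have "\<dots> = 2 ^ (m - card D)"
    by (subst card_Pow, simp, subst card_Diff_subset) (auto simp: D_def)
  also have "\<dots> \<le> 2 ^ (m - K)" using \<tau> by (intro power_increasing) (auto simp: G_def D_def)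
  finally show ?thesis .
qed simp

text \<open>Average over the \<open>2 ^ m\<close> swaps. Each preserves the number of bad pairs,
  while for a fixed pair the \<open>2 * m\<close> sampled points have at most
  \<open>(2 * m + 1) ^ d\<close> traces, each accounting for at most \<open>2 ^ (m - K)\<close>
  swaps into a bad pair.\<close>

lemma double_sampling:
  fixes F :: "'a set set" and f :: "'i \<Rightarrow> 'a"
  assumes vc: "vc_less F d" and I: "finite I" and Km: "K \<le> m"
  defines "bad \<equiv> {p \<in> PiE {..<m} (\<lambda>_. I) \<times> PiE {..<m} (\<lambda>_. I).
              \<exists>A\<in>F. (\<forall>i<m. f (fst p i) \<notin> A) \<and> K \<le> card {i\<in>{..<m}. f (snd p i) \<in> A}}"
  shows "2 ^ K * card bad \<le> (2 * m + 1) ^ d * (card I ^ m * card I ^ m)"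
proof -
  let ?T = "PiE {..<m} (\<lambda>_. I) \<times> PiE {..<m} (\<lambda>_. I)"
  have finT: "finite ?T" using I by (simp add: finite_PiE)
  have swapT: "swap \<sigma> p \<in> ?T" if "p \<in> ?T" "\<sigma> \<subseteq> {..<m}" for \<sigma> p
    using that by (auto simp: swap_def PiE_iff extensional_def)
  have bad_swap: "card {p \<in> ?T. swap \<sigma> p \<in> bad} = card bad" if "\<sigma> \<subseteq> {..<m}" for \<sigma>
  proof (rule bij_betw_same_card[of "swap \<sigma>"], rule bij_betwI[where g = "swap \<sigma>"])
    show "swap \<sigma> \<in> bad \<rightarrow> {p \<in> ?T. swap \<sigma> p \<in> bad}"
      using that swapT by (fastforce simp: swap_swap bad_def)
  qed (auto simp: swap_swap)
  have per: "card {\<sigma> \<in> Pow {..<m}. swap \<sigma> p \<in> bad} \<le> (2 * m + 1) ^ d * 2 ^ (m - K)" if "p \<in> ?T" for p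
  proof -
    \<comment> \<open>Index \<open>(i, False)\<close> stands for point \<open>i\<close> of the first
      tuple, \<open>(i, True)\<close> for point \<open>i\<close> of the second; repeated points are
      kept apart.\<close>
    define J where "J = {..<m} \<times> (UNIV :: bool set)"
    define g where "g = (\<lambda>(i, b). f (if b then snd p i else fst p i))"
    define \<T> where "\<T> = (\<lambda>A. {j \<in> J. g j \<in> A}) ` F"
    define G where "G T = {\<sigma>. \<sigma> \<subseteq> {..<m} \<and> (\<forall>i<m. (i, i \<in> \<sigma>) \<notin> T)
                       \<and> K \<le> card {i\<in>{..<m}. (i, i \<notin> \<sigma>) \<in> T}}" for T
    have finJ: "finite J" by (simp add: J_def)
    have \<T>J: "\<T> \<subseteq> Pow J" by (auto simp: \<T>_def)
    then have fin\<T>: "finite \<T>" using finJ by (meson finite_Pow_iff finite_subset)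
    have c\<T>: "card \<T> \<le> (2 * m + 1) ^ d"
      using sauer_shelah[OF finJ \<T>J vc_less_traces[OF vc, of J g, folded \<T>_def]] 
      by (simp add: J_def card_cartesian_product mult.commute)
    have "{\<sigma> \<in> Pow {..<m}. swap \<sigma> p \<in> bad} \<subseteq> (\<Union>T\<in>\<T>. G T)"
    proof
      fix \<sigma> assume "\<sigma> \<in> {\<sigma> \<in> Pow {..<m}. swap \<sigma> p \<in> bad}"
      then obtain A where \<sigma>: "\<sigma> \<subseteq> {..<m}" and A: "A \<in> F" "\<forall>i<m. f (fst (swap \<sigma> p) i) \<notin> A"
        "K \<le> card {i\<in>{..<m}. f (snd (swap \<sigma> p) i) \<in> A}"
        by (auto simp: bad_def)
      let ?tr = "{j \<in> J. g j \<in> A}"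
      have "{i\<in>{..<m}. f (snd (swap \<sigma> p) i) \<in> A} = {i\<in>{..<m}. (i, i \<notin> \<sigma>) \<in> ?tr}"
        by (auto simp: swap_def J_def g_def)
      moreover have "(i, i \<in> \<sigma>) \<notin> ?tr" if "i < m" for i
        using A(2) that by (auto simp: swap_def J_def g_def split: if_splits)
      ultimately have "\<sigma> \<in> G ?tr" using \<sigma> A by (auto simp: G_def)
      then show "\<sigma> \<in> (\<Union>T\<in>\<T>. G T)" using A(1) by (auto simp: \<T>_def)
    qed
    moreover have "finite (G T)" for T
      by (rule finite_subset[of _ "Pow {..<m}"]) (auto simp: G_def)
    ultimately have "card {\<sigma> \<in> Pow {..<m}. swap \<sigma> p \<in> bad} \<le> card (\<Union>T\<in>\<T>. G T)"
      using fin\<T> by (intro card_mono) auto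
    also have "\<dots> \<le> (\<Sum>T\<in>\<T>. card (G T))" by (rule card_UN_le[OF fin\<T>])
    also have "\<dots> \<le> (\<Sum>T\<in>\<T>. 2 ^ (m - K))"
      unfolding G_def by (intro sum_mono card_good_swaps Km)
    also have "\<dots> \<le> (2 * m + 1) ^ d * 2 ^ (m - K)" using c\<T> by simp
    finally show ?thesis .
  qed
  have "2 ^ m * card bad = (\<Sum>\<sigma>\<in>Pow {..<m}. card {p \<in> ?T. swap \<sigma> p \<in> bad})"
    using bad_swap by (simp add: card_Pow)
  also have "\<dots> = (\<Sum>\<sigma>\<in>Pow {..<m}. \<Sum>p\<in>?T. of_bool (swap \<sigma> p \<in> bad))"
    using finT by (simp add: Int_def)
  also have "\<dots> = (\<Sum>p\<in>?T. \<Sum>\<sigma>\<in>Pow {..<m}. of_bool (swap \<sigma> p \<in> bad))"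
    by (rule sum.swap)
  also have "\<dots> = (\<Sum>p\<in>?T. card {\<sigma> \<in> Pow {..<m}. swap \<sigma> p \<in> bad})"
    by (simp add: Int_def)
  also have "\<dots> \<le> (\<Sum>p\<in>?T. (2 * m + 1) ^ d * 2 ^ (m - K))"
    by (intro sum_mono per)
  also have "\<dots> = (2 * m + 1) ^ d * 2 ^ (m - K) * (card I ^ m * card I ^ m)"
    by (simp add: card_cartesian_product card_PiE)
  finally have "2 ^ (m - K) * (2 ^ K * card bad)
      \<le> 2 ^ (m - K) * ((2 * m + 1) ^ d * (card I ^ m * card I ^ m))"
    using Km by (simp add: mult_ac power_add[symmetric])
  then show ?thesis by simp
qed

text \<open>Supplies the threshold \<open>K\<close> for which the lower and upper bounds on the
  number of bad pairs contradict each other.\<close>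

lemma poly_less_exp: "\<exists>K::nat. K > 0 \<and> 2 * q * (2 * (2 * q * K) + 1) ^ d < (2::nat) ^ K"
proof (cases "q = 0")
  case False
  then have "real q > 0" by simp
  then have "eventually (\<lambda>K::nat. 2 * real q * (2 * (2 * real q * real K) + 1) ^ d < 2 ^ K) at_top"
    by real_asymp
  then have "eventually (\<lambda>K::nat. K > 0 \<and> 2 * real q * (2 * (2 * real q * real K) + 1) ^ d < 2 ^ K) at_top"
    using eventually_gt_at_top[of 0] by eventually_elim simp
  then obtain K :: nat where K: "K > 0" "2 * real q * (2 * (2 * real q * real K) + 1) ^ d < 2 ^ K"
    using eventually_happens'[OF sequentially_bot] by blast
  have "real (2 * q * (2 * (2 * q * K) + 1) ^ d) < real (2 ^ K)" using K(2) by (simp add: add.commute)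
  then show ?thesis using K(1) of_nat_less_iff by blast
qed auto

text \<open>Here \<open>\<epsilon> = 1 / q\<close>. If no \<open>m\<close> points form a net, every
  tuple misses a heavy range, which at least a \<open>1 / (2 * q)\<close> fraction of the second
  tuples hits \<open>K\<close> times or more; these are more bad pairs than double sampling
  permits.\<close>

theorem epsilon_net:
  fixes F :: "'a set set"
  assumes vc: "vc_less F d"
  shows "\<exists>s. \<forall>(I :: 'i set) f. finite I \<longrightarrow> (\<exists>N\<subseteq>I. card N \<le> s \<and>
     (\<forall>A\<in>F. card I < q * card {i\<in>I. f i \<in> A} \<longrightarrow> (\<exists>i\<in>N. f i \<in> A)))"
proof -
  obtain K :: nat where K: "K > 0" "2 * q * (2 * (2 * q * K) + 1) ^ d < 2 ^ K"
    using poly_less_exp by blast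
  define m where "m = 2 * q * K"
  have "\<exists>N\<subseteq>I. card N \<le> m \<and> (\<forall>A\<in>F. card I < q * card {i\<in>I. f i \<in> A} \<longrightarrow> (\<exists>i\<in>N. f i \<in> A))"
    if I: "finite I" for I :: "'i set" and f
  proof (cases "q = 0 \<or> I = {}")
    case True
    then show ?thesis using I by (intro exI[of _ "{}"]) auto
  next
    case False
    then have Km: "K \<le> m" and I0: "card I > 0" and q0: "q > 0" using I by (auto simp: m_def card_gt_0_iff)
    let ?T = "PiE {..<m} (\<lambda>_. I)"
    have finT: "finite ?T" using I by (simp add: finite_PiE)
    show ?thesis
    proof (rule ccontr)
      assume no_net: "\<not> ?thesis"
      have "\<exists>A\<in>F. card I \<le> q * card {i\<in>I. f i \<in> A} \<and> (\<forall>i<m. f (x i) \<notin> A)" if "x \<in> ?T" for x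
      proof -
        have "x ` {..<m} \<subseteq> I" "card (x ` {..<m}) \<le> m"
          using that card_image_le[of "{..<m}" x] by (auto simp: PiE_iff)
        then obtain A where "A \<in> F" "card I < q * card {i\<in>I. f i \<in> A}" "\<not> (\<exists>i\<in>x ` {..<m}. f i \<in> A)"
          using no_net by blast
        then show ?thesis by (intro bexI[of _ A]) auto
      qed
      then obtain r where r: "\<And>x. x \<in> ?T \<Longrightarrow> r x \<in> F \<and> card I \<le> q * card {i\<in>I. f i \<in> r x} \<and> (\<forall>i<m. f (x i) \<notin> r x)"
        by metis
      define bad where "bad = {p \<in> ?T \<times> ?T. \<exists>A\<in>F. (\<forall>i<m. f (fst p i) \<notin> A) \<and> K \<le> card {i\<in>{..<m}. f (snd p i) \<in> A}}"
      define hit where "hit x = {y \<in> ?T. K \<le> card {i\<in>{..<m}. y i \<in> {i. f i \<in> r x}}}" for x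
      have fin_hit: "finite (hit x)" for x using finT by (auto simp: hit_def)
      have fin_bad: "finite bad" using finT by (auto simp: bad_def)
      have "card I ^ m * card I ^ m = (\<Sum>x\<in>?T. card I ^ m)"
        by (simp add: card_PiE)
      also have "\<dots> \<le> (\<Sum>x\<in>?T. 2 * q * card (hit x))"
        unfolding hit_def using r
        by (intro sum_mono many_hitting_tuples[OF I _ m_def K(1) q0]) (auto simp: Int_def)
      also have "\<dots> = 2 * q * card (Sigma ?T hit)"
        using finT fin_hit by (simp add: sum_distrib_left)
      also have "\<dots> \<le> 2 * q * card bad"
      proof -
        have "Sigma ?T hit \<subseteq> bad"
        proof (clarify, goal_cases)
          case (1 x y)
          then show ?case using r[of x] by (auto simp: bad_def hit_def intro!: bexI[of _ "r x"])
        qed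
        then show ?thesis using fin_bad by (intro mult_left_mono card_mono) auto
      qed
      finally have low: "card I ^ m * card I ^ m \<le> 2 * q * card bad" .
      have "2 ^ K * (card I ^ m * card I ^ m) \<le> 2 * q * (2 ^ K * card bad)"
        using mult_left_mono[OF low, of "2 ^ K"] by (simp add: mult_ac)
      also have "\<dots> \<le> 2 * q * ((2 * m + 1) ^ d * (card I ^ m * card I ^ m))"
        using double_sampling[OF vc I Km, of f, folded bad_def] by (intro mult_left_mono) auto
      also have "\<dots> = 2 * q * (2 * m + 1) ^ d * (card I ^ m * card I ^ m)" by simp
      also have "\<dots> < 2 ^ K * (card I ^ m * card I ^ m)"
        using K(2) I0 by (intro mult_strict_right_mono) (auto simp: m_def)
      finally show False by simp
    qed
  qed
  then show ?thesis by (intro exI[of _ m] allI impI)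
qed

subsection \<open>Lower bounds from fooling sets\<close>

text \<open>Hypotheses become the sets of examples they get wrong: consistency is disjointness, and
  a net must hit every heavy error set.\<close>

definition err :: "('x \<Rightarrow> bool) \<Rightarrow> 'x example set" where
  "err h = {(x, y). h x \<noteq> y}"

definition realizes :: "('x \<Rightarrow> bool) set \<Rightarrow> 'x example set \<Rightarrow> bool" where
  "realizes H A \<longleftrightarrow> (\<exists>h\<in>H. err h \<inter> A = {})"

text \<open>\<open>vc_less (err ` H) (d + 1)\<close> says that the VC dimension of \<open>H\<close> is at most \<open>d\<close> (flipping labels
  does not affect shattering), and \<open>covc_le H k\<close> that its coVC dimension is at most \<open>k\<close>.\<close>
definition covc_le :: "('x \<Rightarrow> bool) set \<Rightarrow> nat \<Rightarrow> bool" where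
  "covc_le H k \<longleftrightarrow> (\<forall>A. finite A \<longrightarrow> \<not> realizes H A \<longrightarrow> (\<exists>A'\<subseteq>A. card A' \<le> k \<and> \<not> realizes H A'))"

lemma realizable_iff: "realizable H S \<longleftrightarrow> realizes H (set S)"
  unfolding realizable_def realizes_def err_def by (intro bex_cong refl) auto

lemma realizes_mono: "realizes H B \<Longrightarrow> A \<subseteq> B \<Longrightarrow> realizes H A"
  unfolding realizes_def by blast

section \<open>Transcripts and the rectangle property\<close>

lemma length_run_Turn: "nxt P (run P Sa Sb k) = Turn p \<Longrightarrow> length (run P Sa Sb k) = k"
  by (induction k arbitrary: p) (auto simp: Let_def split: step.splits)

lemma length_run_le: "length (run P Sa Sb k) \<le> k"
  by (induction k) (auto simp: Let_def split: step.splits)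

lemma take_run: "k \<le> T \<Longrightarrow> take k (run P Sa Sb T) = run P Sa Sb k"
proof (induction T)
  case (Suc T)
  show ?case
  proof (cases "k = Suc T")
    case True
    then show ?thesis using length_run_le[of P Sa Sb "Suc T"] by (simp del: run.simps)
  next
    case False
    then show ?thesis
      using Suc length_run_Turn[of P Sa Sb T] by (auto simp: Let_def split: step.splits)
  qed
qed simp

lemma run_halted:
  assumes "nxt P (run P Sa Sb k) = Output b" "k \<le> T"
  shows "run P Sa Sb T = run P Sa Sb k"
  using assms(2,1) by (induction T rule: dec_induct) (auto simp: Let_def)

lemma nth_run:
  assumes "i < length (run P Sa Sb k)"
  shows "\<exists>p. nxt P (take i (run P Sa Sb k)) = Turn p \<and>
    run P Sa Sb k ! i = say P p (if p then Sa else Sb) (take i (run P Sa Sb k))"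
  using assms
proof (induction k)
  case (Suc k)
  show ?case
  proof (cases "nxt P (run P Sa Sb k)")
    case (Output b)
    then show ?thesis using Suc by simp
  next
    case (Turn p)
    then show ?thesis using Suc
      by (cases "i < length (run P Sa Sb k)") (auto simp: Let_def nth_append)
  qed
qed simp

text \<open>The rectangle property of deterministic protocols.\<close>
lemma run_cross:
  assumes "run P a b T = run P a' b' T"
  shows "run P a b' T = run P a b T"
proof -
  have eq: "run P a b k = run P a' b' k" if "k \<le> T" for k
    using assms take_run[OF that] by metis
  \<comment> \<open>Alice's messages in the crossed run are those of the run on
    \<open>(a, b)\<close>, Bob's those of the run on \<open>(a', b')\<close>, and these two runs
    agree.\<close>
  have "run P a b' k = run P a b k" if "k \<le> T" for k
    using that
  proof (induction k)
    case (Suc k)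
    then show ?case using eq[of k] eq[of "Suc k"] by (auto simp: Let_def split: step.splits if_splits)
  qed simp
  then show ?thesis by simp
qed

lemma sum_powers_le: "(\<Sum>i\<le>n. c ^ i) \<le> (c + 1 :: nat) ^ n"
proof (induction n)
  case (Suc n)
  have "c ^ n \<le> (c + 1) ^ n" by (rule power_mono) auto
  then have "c * c ^ n \<le> c * (c + 1) ^ n" by (rule mult_left_mono) simp
  then have "c ^ Suc n \<le> c * (c + 1) ^ n" by simp
  with Suc have "(\<Sum>i\<le>n. c ^ i) + c ^ Suc n \<le> (c + 1) ^ n + c * (c + 1) ^ n" by (rule add_mono)
  then show ?case by simp
qed simp

lemma run_msgs:
  assumes "valid_transcript P Sa Sb (run P Sa Sb T)" "fst ` set (Sa @ Sb) \<subseteq> R"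
  shows "set (run P Sa Sb T) \<subseteq> range MBit \<union> MEx ` (R \<times> UNIV)"
proof
  fix m assume "m \<in> set (run P Sa Sb T)"
  then obtain i where i: "i < length (run P Sa Sb T)" "m = run P Sa Sb T ! i"
    by (auto simp: in_set_conv_nth)
  obtain p where "nxt P (take i (run P Sa Sb T)) = Turn p" using nth_run[OF i(1)] by blast
  then have *: "case m of MBit _ \<Rightarrow> True | MEx z \<Rightarrow> z \<in> set (if p then Sa else Sb)"
    using assms(1) i unfolding valid_transcript_def by fastforce
  show "m \<in> range MBit \<union> MEx ` (R \<times> UNIV)"
  proof (cases m)
    case (MEx z)
    then have "fst z \<in> R" using * assms(2) by (auto split: if_splits)
    then show ?thesis using MEx by (cases z) auto
  qed auto
qed

lemma card_msgs:
  assumes "finite R"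
  shows "finite (range MBit \<union> MEx ` (R \<times> (UNIV :: bool set)))"
    "card (range MBit \<union> MEx ` (R \<times> (UNIV :: bool set))) \<le> 2 * card R + 2"
proof -
  have "card (range MBit \<union> MEx ` (R \<times> (UNIV :: bool set))) \<le> card (range (MBit :: bool \<Rightarrow> 'a msg)) + card (MEx ` (R \<times> (UNIV :: bool set)))"
    by (rule card_Un_le)
  also have "\<dots> \<le> card (UNIV :: bool set) + card (R \<times> (UNIV :: bool set))"
    using assms by (intro add_mono card_image_le) auto
  finally show "card (range MBit \<union> MEx ` (R \<times> (UNIV :: bool set))) \<le> 2 * card R + 2"
    by (simp add: card_cartesian_product)
qed (use assms in auto)

text \<open>If two subsets had the same transcript, both crossed inputs would have it by
  \<open>run_cross\<close> and get the answer \<open>v\<close>, against \<open>cross\<close>. So the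
  subsets of \<open>Y\<close> inject into the possible transcripts.\<close>

lemma fooling_bound:
  assumes dec: "decides_within P H R B" and R: "finite R" and Y: "finite Y"
    and pts: "\<And>A. A \<subseteq> Y \<Longrightarrow> fst ` set (\<alpha> A) \<subseteq> R \<and> fst ` set (\<beta> A) \<subseteq> R"
    and len: "\<And>A. A \<subseteq> Y \<Longrightarrow> length (\<alpha> A) + length (\<beta> A) = n"
    and diag: "\<And>A. A \<subseteq> Y \<Longrightarrow> realizable H (\<alpha> A @ \<beta> A) = v"
    and cross: "\<And>A B. A \<subseteq> Y \<Longrightarrow> B \<subseteq> Y \<Longrightarrow> A \<noteq> B \<Longrightarrow>
      realizable H (\<alpha> A @ \<beta> B) \<noteq> v \<or> realizable H (\<alpha> B @ \<beta> A) \<noteq> v"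
  shows "2 ^ card Y \<le> (2 * card R + 3) ^ nat \<lfloor>B n\<rfloor>"
proof -
  define T where "T = nat \<lfloor>B n\<rfloor>"
  define t where "t A = run P (\<alpha> A) (\<beta> A) T" for A
  define M where "M = range MBit \<union> MEx ` (R \<times> (UNIV :: bool set))"
  have halt: "nxt P (run P (\<alpha> A) (\<beta> C) (nat \<lfloor>B (length (\<alpha> A) + length (\<beta> C))\<rfloor>)) = Output (realizable H (\<alpha> A @ \<beta> C))"
    if "A \<subseteq> Y" "C \<subseteq> Y" for A C
    using dec pts[OF that(1)] pts[OF that(2)] unfolding decides_within_def
    by (metis (no_types, lifting) Un_subset_iff image_Un set_append)
  have fin: "nxt P (t A) = Output v" if "A \<subseteq> Y" for A
    using halt[OF that that] len[OF that] diag[OF that] by (simp add: t_def T_def)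
  have out: "realizable H (\<alpha> A @ \<beta> C) = v" if "A \<subseteq> Y" "C \<subseteq> Y" "t A = t C" for A C
  proof -
    have 1: "run P (\<alpha> A) (\<beta> C) T = t A"
      using run_cross that(3) unfolding t_def by blast
    \<comment> \<open>A crossed input may have a size other than \<open>n\<close>, hence another
      round bound; halted runs no longer change, so both bounds give the same transcript.\<close>
    let ?T = "nat \<lfloor>B (length (\<alpha> A) + length (\<beta> C))\<rfloor>"
    have "run P (\<alpha> A) (\<beta> C) T = run P (\<alpha> A) (\<beta> C) ?T"
      using run_halted[OF halt[OF that(1,2)], of T] run_halted[of P "\<alpha> A" "\<beta> C" T v ?T] fin[OF that(1)] 1
      by (cases "T \<le> ?T") auto
    then show ?thesis using halt[OF that(1,2)] fin[OF that(1)] 1 by simp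
  qed
  have "inj_on t (Pow Y)"
    by (rule inj_onI) (metis out cross PowD)
  moreover have "t ` Pow Y \<subseteq> {xs. set xs \<subseteq> M \<and> length xs \<le> T}"
  proof (intro image_subsetI CollectI conjI)
    fix A assume A: "A \<in> Pow Y"
    then have "fst ` set (\<alpha> A @ \<beta> A) \<subseteq> R" using pts[of A] by auto
    moreover from this have "valid_transcript P (\<alpha> A) (\<beta> A) (t A)"
      using dec A len[of A] unfolding decides_within_def Let_def t_def T_def by auto
    ultimately show "set (t A) \<subseteq> M" unfolding t_def M_def by (intro run_msgs)
    show "length (t A) \<le> T" unfolding t_def by (rule length_run_le)
  qed
  moreover have "finite {xs. set xs \<subseteq> M \<and> length xs \<le> T}"
    using card_msgs(1)[OF R] by (intro finite_lists_length_le) (simp add: M_def)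
  ultimately have "card (Pow Y) \<le> card {xs. set xs \<subseteq> M \<and> length xs \<le> T}"
    by (rule card_inj_on_le)
  also have "\<dots> = (\<Sum>i\<le>T. card M ^ i)"
    using card_msgs(1)[OF R] by (intro card_lists_length_le) (simp add: M_def)
  also have "\<dots> \<le> (card M + 1) ^ T" by (rule sum_powers_le)
  also have "\<dots> \<le> (2 * card R + 3) ^ T"
    using card_msgs(2)[OF R] by (intro power_mono) (simp_all add: M_def)
  finally show ?thesis by (simp add: card_Pow Y T_def)
qed

section \<open>Efficient protocols force finite dimensions\<close>

lemma polylog_less_linear:
  "eventually (\<lambda>N::nat. c * (log 2 (real N + 2)) ^ m * log 2 (2 * real N + 3) < real N) at_top"
  by real_asymp

text \<open>Asking for the bound on \<open>B\<close> only when \<open>n \<ge> card R\<close> covers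
  all three conditions at once, including bounds in \<open>card R\<close>; fooling inputs qualify,
  as their size \<open>card Y\<close> is at least the number of their points.\<close>

lemma protocols_imp_finite_dimensions:
  fixes H :: "('x \<Rightarrow> bool) set" and c :: real
  assumes prot: "\<And>R. finite R \<Longrightarrow> \<exists>P B. decides_within P H R B \<and>
      (\<forall>n\<ge>card R. B n \<le> c * (log 2 (real n + 2)) ^ m)" and c: "c \<ge> 0"
  shows "\<exists>d. vc_less (err ` H) d" "\<exists>k. covc_le H k"
proof -
  obtain N0 where N0: "\<And>N. N \<ge> N0 \<Longrightarrow> c * (log 2 (real N + 2)) ^ m * log 2 (2 * real N + 3) < real N"
    using polylog_less_linear[of c m] by (auto simp: eventually_at_top_linorder)
  \<comment> \<open>Applied with \<open>v = True\<close> to shattered sets and with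
    \<open>v = False\<close> to minimal unrealizable sets.\<close>
  have small: "card Y < N0" if Y: "finite Y"
    and pts: "\<And>A. A \<subseteq> Y \<Longrightarrow> fst ` set (\<alpha> A) \<subseteq> fst ` Y \<and> fst ` set (\<beta> A) \<subseteq> fst ` Y"
    and len: "\<And>A. A \<subseteq> Y \<Longrightarrow> length (\<alpha> A) + length (\<beta> A) = card Y"
    and diag: "\<And>A. A \<subseteq> Y \<Longrightarrow> realizable H (\<alpha> A @ \<beta> A) = v"
    and cross: "\<And>A B. A \<subseteq> Y \<Longrightarrow> B \<subseteq> Y \<Longrightarrow> A \<noteq> B \<Longrightarrow>
      realizable H (\<alpha> A @ \<beta> B) \<noteq> v \<or> realizable H (\<alpha> B @ \<beta> A) \<noteq> v" for Y \<alpha> \<beta> v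
  proof (rule ccontr)
    assume "\<not> card Y < N0"
    define N where "N = card Y"
    have R: "finite (fst ` Y)" "card (fst ` Y) \<le> N" using Y by (auto simp: N_def card_image_le)
    obtain P B where P: "decides_within P H (fst ` Y) B" "B N \<le> c * (log 2 (real N + 2)) ^ m"
      using prot[OF R(1)] R(2) by auto
    define T where "T = nat \<lfloor>B N\<rfloor>"
    have "0 \<le> c * (log 2 (real N + 2)) ^ m"
      using c by (intro mult_nonneg_nonneg zero_le_power) (simp_all add: zero_le_log_cancel_iff)
    then have T: "real T \<le> c * (log 2 (real N + 2)) ^ m" using P(2) by (simp add: T_def) linarith
    have "2 ^ N \<le> (2 * card (fst ` Y) + 3) ^ T"
      using fooling_bound[OF P(1) R(1) Y pts len diag cross] by (simp add: N_def T_def)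
    also have "\<dots> \<le> (2 * N + 3) ^ T" using R(2) by (intro power_mono) auto
    finally have "real (2 ^ N) \<le> real ((2 * N + 3) ^ T)" by (rule of_nat_mono)
    then have "log 2 (2 ^ N) \<le> log 2 ((2 * real N + 3) ^ T)"
      by (subst log_le_cancel_iff) (auto intro!: zero_less_power)
    then have "real N \<le> real T * log 2 (2 * real N + 3)"
      by (simp add: log_nat_power)
    also have "\<dots> \<le> c * (log 2 (real N + 2)) ^ m * log 2 (2 * real N + 3)"
      using T by (intro mult_right_mono) (simp_all add: zero_le_log_cancel_iff)
    also have "\<dots> < real N" using \<open>\<not> card Y < N0\<close> by (intro N0) (simp add: N_def)
    finally show False by simp
  qed
  obtain ls :: "'x example set \<Rightarrow> 'x sample" where ls: "\<And>A. finite A \<Longrightarrow> set (ls A) = A \<and> distinct (ls A)"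
    using finite_distinct_list by metis
  have len_ls: "length (ls A) = card A" if "finite A" for A
    using ls[OF that] distinct_card by metis
  \<comment> \<open>Alice labels \<open>A\<close> as in \<open>Y\<close>, Bob flips the labels on the complement of his set: set disjointness.\<close>
  have "card Y < N0" if Y: "finite Y" and sh: "shatters (err ` H) Y" for Y
  proof (rule small[of Y ls "\<lambda>A. map (\<lambda>(x, y). (x, \<not> y)) (ls (Y - A))" True, OF Y])
    have fin: "finite A" "finite (Y - A)" if "A \<subseteq> Y" for A using that Y finite_subset by auto
    fix A assume A: "A \<subseteq> Y"
    show "fst ` set (ls A) \<subseteq> fst ` Y \<and> fst ` set (map (\<lambda>(x, y). (x, \<not> y)) (ls (Y - A))) \<subseteq> fst ` Y"
      using A ls[OF fin(1)[OF A]] ls[OF fin(2)[OF A]] by (auto simp: image_iff) force+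
    show "length (ls A) + length (map (\<lambda>(x, y). (x, \<not> y)) (ls (Y - A))) = card Y"
      using len_ls fin[OF A] A Y by (simp add: card_Diff_subset card_mono)
    \<comment> \<open>Correct on \<open>A\<close> and wrong on the rest of \<open>Y\<close>, hence
      correct on the flipped labels that Bob holds.\<close>
    obtain h where h: "h \<in> H" "err h \<inter> Y = Y - A" using sh[unfolded shatters_def, rule_format, of "Y - A"] by auto
    have "h x = y" if "(x, y) \<in> A" for x y
    proof -
      have "(x, y) \<notin> err h \<inter> Y" unfolding h(2) using that by simp
      then show ?thesis using that A by (auto simp: err_def)
    qed
    moreover have "h x = (\<not> y)" if "(x, y) \<in> Y - A" for x y
      using that unfolding h(2)[symmetric] by (auto simp: err_def)
    ultimately show "realizable H (ls A @ map (\<lambda>(x, y). (x, \<not> y)) (ls (Y - A))) = True"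
      using ls[OF fin(1)[OF A]] ls[OF fin(2)[OF A]] h(1)
      by (auto simp: realizable_def intro!: bexI[of _ h])
    fix B assume B: "B \<subseteq> Y" and "A \<noteq> B"
    \<comment> \<open>The point of \<open>z\<close> occurs with both labels: Alice's from
      \<open>C\<close>, and flipped by Bob because \<open>z \<notin> D\<close>.\<close>
    have no: "\<not> realizable H (ls C @ map (\<lambda>(x, y). (x, \<not> y)) (ls (Y - D)))"
      if C: "C \<subseteq> Y" and D: "D \<subseteq> Y" and z: "z \<in> C" "z \<notin> D" for C D z
    proof
      assume "realizable H (ls C @ map (\<lambda>(x, y). (x, \<not> y)) (ls (Y - D)))"
      then obtain h where h: "\<forall>(x, y)\<in>C \<union> (\<lambda>(x, y). (x, \<not> y)) ` (Y - D). h x = y"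
        using ls[OF fin(1)[OF C]] ls[OF fin(2)[OF D]] by (auto simp: realizable_def)
      obtain x y where xy: "z = (x, y)" by fastforce
      have "(x, y) \<in> C" "(x, \<not> y) \<in> (\<lambda>(x, y). (x, \<not> y)) ` (Y - D)" using C z xy by force+
      then show False using bspec[OF h, of "(x, y)"] bspec[OF h, of "(x, \<not> y)"] by simp
    qed
    have "(\<exists>z. z \<in> A \<and> z \<notin> B) \<or> (\<exists>z. z \<in> B \<and> z \<notin> A)" using \<open>A \<noteq> B\<close> by blast
    then show "realizable H (ls A @ map (\<lambda>(x, y). (x, \<not> y)) (ls (Y - B))) \<noteq> True \<or>
          realizable H (ls B @ map (\<lambda>(x, y). (x, \<not> y)) (ls (Y - A))) \<noteq> True"
      using no[OF A B] no[OF B A] by blast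
  qed
  then show "\<exists>d. vc_less (err ` H) d" unfolding vc_less_def by blast
  \<comment> \<open>On a minimal unrealizable \<open>Y\<close> the joint sample is realizable unless it is all of \<open>Y\<close>.\<close>
  have min_bound: "card Y < N0" if Y: "finite Y" and non: "\<not> realizes H Y" and mn: "\<And>A. A \<subset> Y \<Longrightarrow> realizes H A" for Y
  proof (rule small[of Y ls "\<lambda>A. ls (Y - A)" False, OF Y])
    have fin: "finite A" "finite (Y - A)" if "A \<subseteq> Y" for A using that Y finite_subset by auto
    have un: "set (ls A @ ls (Y - B)) = A \<union> (Y - B)" if "A \<subseteq> Y" "B \<subseteq> Y" for A B
      using ls fin that by simp
    fix A assume A: "A \<subseteq> Y"
    show "fst ` set (ls A) \<subseteq> fst ` Y \<and> fst ` set (ls (Y - A)) \<subseteq> fst ` Y"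
      using A ls[OF fin(1)[OF A]] ls[OF fin(2)[OF A]] by auto
    show "length (ls A) + length (ls (Y - A)) = card Y"
      using len_ls fin[OF A] A Y by (simp add: card_Diff_subset card_mono)
    show "realizable H (ls A @ ls (Y - A)) = False"
      using non A unfolding realizable_iff un[OF A A] by (simp add: Un_absorb1)
    fix B assume B: "B \<subseteq> Y" and "A \<noteq> B"
    \<comment> \<open>Elements of \<open>B - A\<close> are missing from the first union, those of
      \<open>A - B\<close> from the second.\<close>
    have "A \<union> (Y - B) \<subset> Y \<or> B \<union> (Y - A) \<subset> Y" using \<open>A \<noteq> B\<close> A B by blast
    then show "realizable H (ls A @ ls (Y - B)) \<noteq> False \<or> realizable H (ls B @ ls (Y - A)) \<noteq> False"
      unfolding realizable_iff un[OF A B] un[OF B A] using mn by blast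
  qed
  have "covc_le H N0"
    unfolding covc_le_def
  proof (intro allI impI)
    fix A assume A: "finite A" "\<not> realizes H A"
    let ?\<A> = "{A' \<in> Pow A. \<not> realizes H A'}"
    have fin: "finite ?\<A>" and mem: "A \<in> ?\<A>" using A by auto
    obtain Y where Y: "Y \<in> ?\<A>" "\<forall>Z\<in>?\<A>. Z \<subseteq> Y \<longrightarrow> Y = Z"
      using finite_has_minimal2[OF fin mem] by (elim bexE conjE)
    have "realizes H Z" if "Z \<subset> Y" for Z
    proof (rule ccontr)
      assume "\<not> realizes H Z"
      then have "Z \<in> ?\<A>" using that Y(1) by auto
      then show False using bspec[OF Y(2), of Z] that by blast
    qed
    then have "card Y < N0" using Y(1) A(1) finite_subset by (intro min_bound) auto
    then show "\<exists>A'\<subseteq>A. card A' \<le> N0 \<and> \<not> realizes H A'" using Y(1) by (intro exI[of _ Y]) auto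
  qed
  then show "\<exists>k. covc_le H k" ..
qed

subsection \<open>Encoding messages as blocks\<close>

text \<open>A run in which messages have an arbitrary type \<open>'m\<close>; \<open>compile\<close> below turns it into a
  protocol by sending each \<open>'m\<close> as a block of \<open>L\<close> units.\<close>
fun mrun :: "('m list \<Rightarrow> step) \<Rightarrow> (bool \<Rightarrow> 'x sample \<Rightarrow> 'm list \<Rightarrow> 'm) \<Rightarrow> 'x sample \<Rightarrow> 'x sample \<Rightarrow> nat \<Rightarrow> 'm list" where
  "mrun nx sy Sa Sb 0 = []"
| "mrun nx sy Sa Sb (Suc k) =
     (let t = mrun nx sy Sa Sb k in
      case nx t of Output b \<Rightarrow> t | Turn p \<Rightarrow> t @ [sy p (if p then Sa else Sb) t])"

lemma run_conv_mrun: "run P (f Sa) (f Sb) k = mrun (fst P) (\<lambda>p S. snd P p (f S)) Sa Sb k"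
  by (induction k) (auto simp: nxt_def say_def Let_def split: step.split)

text \<open>The tail \<open>u\<close> is the unfinished current block, so decoding works at every
  moment of a run; for a block code the parse is unique (\<open>decode_unique\<close>).\<close>

definition decode :: "('m \<Rightarrow> 'x msg list) \<Rightarrow> nat \<Rightarrow> 'm set \<Rightarrow> 'x msg list \<Rightarrow> 'm list" where
  "decode enc L M t = (SOME ms. set ms \<subseteq> M \<and> (\<exists>u. length u < L \<and> t = concat (map enc ms) @ u))"

text \<open>The guard \<open>m \<in> M\<close> only matters for transcripts that do not occur in a run; it makes every
  message legal there, too.\<close>
definition compile ::
  "('m list \<Rightarrow> step) \<Rightarrow> (bool \<Rightarrow> 'x sample \<Rightarrow> 'm list \<Rightarrow> 'm) \<Rightarrow> ('m \<Rightarrow> 'x msg list) \<Rightarrow> nat \<Rightarrow> 'm set \<Rightarrow> 'x protocol" where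
  "compile nx sy enc L M =
     (\<lambda>t. nx (decode enc L M t),
      \<lambda>p S t. let m = sy p S (decode enc L M t) in
        if m \<in> M then enc m ! (length t mod L) else MBit False)"

locale block_code =
  fixes enc :: "'m \<Rightarrow> 'x msg list" and L :: nat and M :: "'m set"
  assumes L_pos: "L > 0" and enc_inj: "inj_on enc M" and length_enc: "m \<in> M \<Longrightarrow> length (enc m) = L"
begin

lemma decode_unique:
  assumes "set ms \<subseteq> M" "set ms' \<subseteq> M" "length u < L" "length u' < L"
    "concat (map enc ms) @ u = concat (map enc ms') @ u'"
  shows "ms = ms'"
  using assms
proof (induction ms arbitrary: ms')
  case Nil
  then show ?case using length_enc by (cases ms') auto
next
  case (Cons m ms)
  show ?case
  proof (cases ms')
    case Nil
    then show ?thesis using Cons.prems length_enc by auto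
  next
    case (Cons m' ns)
    then have "enc m = enc m'" "concat (map enc ms) @ u = concat (map enc ns) @ u'"
      using Cons.prems length_enc by auto
    then show ?thesis using Cons Cons.prems Cons.IH[of ns] enc_inj by (auto dest: inj_onD)
  qed
qed

lemma decode_eq:
  assumes "set ms \<subseteq> M" "length u < L"
  shows "decode enc L M (concat (map enc ms) @ u) = ms"
  unfolding decode_def
proof (rule some_equality)
  show "set ms \<subseteq> M \<and> (\<exists>u'. length u' < L \<and> concat (map enc ms) @ u = concat (map enc ms) @ u')"
    using assms by auto
next
  fix ms' assume "set ms' \<subseteq> M \<and> (\<exists>u'. length u' < L \<and> concat (map enc ms) @ u = concat (map enc ms') @ u')"
  then obtain u' where "set ms' \<subseteq> M" "length u' < L" "concat (map enc ms) @ u = concat (map enc ms') @ u'"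
    by blast
  then show "ms' = ms" using decode_unique[of ms ms' u u'] assms by simp
qed

lemma length_concat_enc: "set ms \<subseteq> M \<Longrightarrow> length (concat (map enc ms)) = L * length ms"
  by (induction ms) (auto simp: length_enc)

text \<open>Inside a block the decoded list does not change, so the same party keeps the turn for
  \<open>L\<close> units, and \<open>length t mod L\<close> tells it which unit comes next.\<close>

lemma run_compile:
  fixes nx :: "'m list \<Rightarrow> step" and sy :: "bool \<Rightarrow> 'x sample \<Rightarrow> 'm list \<Rightarrow> 'm"
  defines "P \<equiv> compile nx sy enc L M"
  assumes mem: "\<And>k p. nx (mrun nx sy Sa Sb k) = Turn p \<Longrightarrow>
    sy p (if p then Sa else Sb) (mrun nx sy Sa Sb k) \<in> M"
  shows "set (mrun nx sy Sa Sb k) \<subseteq> M \<and> run P Sa Sb (L * k) = concat (map enc (mrun nx sy Sa Sb k))"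
proof (induction k)
  case (Suc k)
  define ms where "ms = mrun nx sy Sa Sb k"
  have ms: "set ms \<subseteq> M" "run P Sa Sb (L * k) = concat (map enc ms)" using Suc by (auto simp: ms_def)
  have dec: "decode enc L M (concat (map enc ms) @ u) = ms" if "length u < L" for u
    by (rule decode_eq[OF ms(1) that])
  show ?case
  proof (cases "nx ms")
    case (Output b)
    have "nxt P (run P Sa Sb (L * k)) = Output b"
      using dec[of "[]"] L_pos ms Output by (simp add: nxt_def P_def compile_def)
    then have "run P Sa Sb (L * Suc k) = run P Sa Sb (L * k)" by (rule run_halted) simp
    then show ?thesis using Output ms by (simp add: ms_def del: run.simps)
  next
    case (Turn p)
    define m where "m = sy p (if p then Sa else Sb) ms"
    have m: "m \<in> M" using mem Turn by (simp add: m_def ms_def)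
    have "run P Sa Sb (L * k + j) = concat (map enc ms) @ take j (enc m)" if "j \<le> L" for j
      using that
    proof (induction j)
      case (Suc j)
      let ?t = "concat (map enc ms) @ take j (enc m)"
      have len: "length (take j (enc m)) = j" using Suc.prems length_enc[OF m] by simp
      have d: "decode enc L M ?t = ms" by (rule dec) (use len Suc.prems in simp)
      have "length ?t mod L = j"
        using len Suc.prems by (simp only: length_append length_concat_enc[OF ms(1)]) simp
      then have "say P p (if p then Sa else Sb) ?t = enc m ! j"
        using m by (simp add: say_def P_def compile_def d m_def[symmetric])
      moreover have "nxt P ?t = Turn p" using d Turn by (simp add: nxt_def P_def compile_def)
      moreover have "take (Suc j) (enc m) = take j (enc m) @ [enc m ! j]"
        using Suc.prems length_enc[OF m] by (intro take_Suc_conv_app_nth) simp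
      ultimately show ?case using Suc by (simp add: Let_def)
    qed (simp add: ms)
    from this[of L] have "run P Sa Sb (L * Suc k) = concat (map enc ms) @ enc m"
      using length_enc[OF m] by (simp add: add.commute)
    then show ?thesis using Turn ms m by (simp add: ms_def m_def Let_def)
  qed
qed simp

text \<open>Membership in \<open>M\<close> is asked only along runs on admissible inputs. The
  halting index \<open>k\<close> may vary with the input, because a halted run stays frozen until
  the round bound.\<close>

lemma decides_compile:
  fixes nx :: "'m list \<Rightarrow> step" and sy :: "bool \<Rightarrow> 'x sample \<Rightarrow> 'm list \<Rightarrow> 'm"
  assumes own: "\<And>p S ms z. sy p S ms \<in> M \<Longrightarrow> MEx z \<in> set (enc (sy p S ms)) \<Longrightarrow> z \<in> set S"
    and mem: "\<And>Sa Sb k p. fst ` set (Sa @ Sb) \<subseteq> R \<Longrightarrow> nx (mrun nx sy Sa Sb k) = Turn p \<Longrightarrow>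
      sy p (if p then Sa else Sb) (mrun nx sy Sa Sb k) \<in> M"
    and halt: "\<And>Sa Sb. fst ` set (Sa @ Sb) \<subseteq> R \<Longrightarrow>
      \<exists>k. real (L * k) \<le> B (length Sa + length Sb) \<and> nx (mrun nx sy Sa Sb k) = Output (realizable H (Sa @ Sb))"
  shows "decides_within (compile nx sy enc L M) H R B"
  unfolding decides_within_def Let_def
proof (intro allI impI conjI)
  fix Sa Sb :: "'x sample" assume R: "fst ` set (Sa @ Sb) \<subseteq> R"
  let ?P = "compile nx sy enc L M" and ?T = "nat \<lfloor>B (length Sa + length Sb)\<rfloor>"
  obtain k where k: "real (L * k) \<le> B (length Sa + length Sb)"
    "nx (mrun nx sy Sa Sb k) = Output (realizable H (Sa @ Sb))" using halt[OF R] by blast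
  note rc = run_compile[where nx = nx and sy = sy and Sa = Sa and Sb = Sb and k = k, OF mem[OF R]]
  have nx: "nxt ?P (run ?P Sa Sb (L * k)) = Output (realizable H (Sa @ Sb))"
    using decode_eq[OF conjunct1[OF rc], of "[]"] L_pos k(2) conjunct2[OF rc] by (simp add: nxt_def compile_def)
  have "L * k \<le> ?T" using k(1) by (rule le_nat_floor)
  then have "run ?P Sa Sb ?T = run ?P Sa Sb (L * k)" by (rule run_halted[OF nx])
  then show "nxt ?P (run ?P Sa Sb ?T) = Output (realizable H (Sa @ Sb))"
    using nx by (rule ssubst)
  have say_own: "z \<in> set S" if eq: "say ?P p S t = MEx z" for p S t z
  proof -
    let ?m = "sy p S (decode enc L M t)"
    have m: "?m \<in> M" "enc ?m ! (length t mod L) = MEx z"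
      using eq by (auto simp: say_def compile_def Let_def split: if_splits)
    then have "MEx z \<in> set (enc ?m)"
      using nth_mem[of "length t mod L" "enc ?m"] length_enc[OF m(1)] L_pos by simp
    then show ?thesis by (rule own[OF m(1)])
  qed
  show "valid_transcript ?P Sa Sb (run ?P Sa Sb ?T)"
    unfolding valid_transcript_def
  proof (intro allI impI)
    fix i assume "i < length (run ?P Sa Sb ?T)"
    then obtain p where p: "nxt ?P (take i (run ?P Sa Sb ?T)) = Turn p"
      "run ?P Sa Sb ?T ! i = say ?P p (if p then Sa else Sb) (take i (run ?P Sa Sb ?T))"
      using nth_run[of i ?P Sa Sb ?T] by auto
    show "case nxt ?P (take i (run ?P Sa Sb ?T)) of Output _ \<Rightarrow> True
      | Turn p \<Rightarrow> (case run ?P Sa Sb ?T ! i of MBit _ \<Rightarrow> True | MEx z \<Rightarrow> z \<in> set (if p then Sa else Sb))"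
      using say_own[of p "if p then Sa else Sb" "take i (run ?P Sa Sb ?T)"]
      unfolding p step.case by (cases "say ?P p (if p then Sa else Sb) (take i (run ?P Sa Sb ?T))") simp_all
  qed
qed

end

section \<open>Simulation in Yao's model\<close>

lemma log_ge_1: "1 \<le> log 2 (real n + 2)"
  by (subst one_le_log_cancel_iff) auto

text \<open>Removing duplicates makes the sample length at most \<open>4 * card R\<close>, and an example with its point in
  \<open>R\<close> costs logarithmically many bits.\<close>
lemma yao_simulation:
  fixes H :: "('x \<Rightarrow> bool) set"
  assumes P: "decides_within P H UNIV (\<lambda>n. c * log 2 (real n + 2))" and c: "c \<ge> 0" and R: "finite R"
  shows "\<exists>P'. bits_only P' \<and> decides_within P' H R (\<lambda>_. 12 * c * (log 2 (real (card R) + 2)) ^ 2)"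
proof -
  define r where "r = card R"
  define M where "M = range MBit \<union> MEx ` (R \<times> (UNIV :: bool set))"
  have M: "finite M" "card M \<le> 2 * r + 2" using card_msgs[OF R] by (simp_all add: M_def r_def)
  \<comment> \<open>Block length: \<open>2 ^ L\<close> binary words suffice for the at most
    \<open>2 * r + 2\<close> messages over \<open>R\<close>.\<close>
  define L where "L = nat \<lceil>log 2 (real (2 * r + 2))\<rceil> + 1"
  have "log 2 (real (2 * r + 2)) \<le> real L" unfolding L_def by linarith
  then have "real (2 * r + 2) \<le> 2 powr real L" by (subst (asm) log_le_iff) auto
  then have "2 * r + 2 \<le> 2 ^ L" by (simp add: powr_realpow flip: of_nat_le_iff[where 'a=real])
  then have "card M \<le> card {xs :: bool list. set xs \<subseteq> UNIV \<and> length xs = L}"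
    using M(2) by (subst card_lists_length_eq) auto
  moreover have finL: "finite {xs :: bool list. set xs \<subseteq> UNIV \<and> length xs = L}"
    by (rule finite_lists_length_eq) simp
  ultimately obtain e where e: "inj_on e M" "e ` M \<subseteq> {xs :: bool list. set xs \<subseteq> UNIV \<and> length xs = L}"
    using card_le_inj[OF M(1) finL] by metis
  define enc :: "'x msg \<Rightarrow> 'x msg list" where "enc m = map MBit (e m)" for m
  interpret block_code enc L M
  proof
    show "L > 0" by (simp add: L_def)
    show "inj_on enc M"
      using e(1) by (auto simp: inj_on_def enc_def inj_map_eq_map inj_def)
    show "length (enc m) = L" if "m \<in> M" for m using e(2) that by (auto simp: enc_def)
  qed
  define nx where "nx = fst P"
  define sy where "sy = (\<lambda>p S. snd P p (remdups S))"
  have run: "mrun nx sy Sa Sb k = run P (remdups Sa) (remdups Sb) k" for Sa Sb k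
    using run_conv_mrun[of P remdups] by (simp add: nx_def sy_def)
  have real_remdups: "realizable H (remdups Sa @ remdups Sb) = realizable H (Sa @ Sb)" for Sa Sb
    by (simp add: realizable_def)
  define T where "T Sa Sb = nat \<lfloor>c * log 2 (real (length (remdups Sa) + length (remdups Sb)) + 2)\<rfloor>"
    for Sa Sb :: "'x sample"
  have halts: "nxt P (run P (remdups Sa) (remdups Sb) (T Sa Sb)) = Output (realizable H (Sa @ Sb))"
    and val: "valid_transcript P (remdups Sa) (remdups Sb) (run P (remdups Sa) (remdups Sb) (T Sa Sb))" for Sa Sb
    using P[unfolded decides_within_def, rule_format, of "remdups Sa" "remdups Sb"]
    by (simp_all add: Let_def real_remdups T_def)
  have "decides_within (compile nx sy enc L M) H R (\<lambda>_. 12 * c * (log 2 (real (card R) + 2)) ^ 2)"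
  proof (rule decides_compile)
    fix p S ms z assume "MEx z \<in> set (enc (sy p S ms))"
    then show "z \<in> set S" by (auto simp: enc_def)
  next
    fix Sa Sb k p assume SR: "fst ` set (Sa @ Sb) \<subseteq> R" and turn: "nx (mrun nx sy Sa Sb k) = Turn p"
    let ?T = "T Sa Sb"
    let ?run = "run P (remdups Sa) (remdups Sb)"
    have T': "nxt P (?run k) = Turn p" using turn unfolding run by (simp add: nxt_def nx_def)
    \<comment> \<open>A run still going at \<open>k\<close> has not reached the round bound, so its
      next message appears in the final transcript, whose messages lie in \<open>M\<close>.\<close>
    have "k < ?T"
    proof (rule ccontr)
      assume "\<not> k < ?T"
      then have "?run k = ?run ?T" by (intro run_halted[OF halts]) simp
      then show False using T' halts[of Sa Sb] by simp
    qed
    then have "?run (Suc k) = take (Suc k) (?run ?T)" by (intro take_run[symmetric]) simp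
    then have "set (?run (Suc k)) \<subseteq> set (?run ?T)" using set_take_subset by metis
    also have "\<dots> \<subseteq> M" unfolding M_def by (rule run_msgs[OF val]) (use SR in simp)
    finally have "set (?run (Suc k)) \<subseteq> M" .
    moreover have "?run (Suc k) = ?run k @ [say P p (if p then remdups Sa else remdups Sb) (?run k)]"
      using T' by (simp add: Let_def)
    ultimately have "say P p (if p then remdups Sa else remdups Sb) (?run k) \<in> M" by simp
    moreover have "sy p (if p then Sa else Sb) (mrun nx sy Sa Sb k) = say P p (if p then remdups Sa else remdups Sb) (?run k)"
      unfolding run by (simp add: sy_def say_def)
    ultimately show "sy p (if p then Sa else Sb) (mrun nx sy Sa Sb k) \<in> M" by simp
  next
    fix Sa Sb :: "'x sample" assume SR: "fst ` set (Sa @ Sb) \<subseteq> R"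
    let ?n = "length (remdups Sa) + length (remdups Sb)"
    let ?l = "log 2 (real r + 2)"
    let ?k = "nat \<lfloor>c * log 2 (real ?n + 2)\<rfloor>"
    have len: "length (remdups S) \<le> 2 * r" if "fst ` set S \<subseteq> R" for S :: "'x sample"
    proof -
      have "set S \<subseteq> R \<times> UNIV" using that by (auto simp: image_subset_iff)
      then have "card (set S) \<le> card (R \<times> (UNIV :: bool set))" using R by (intro card_mono) auto
      then show ?thesis by (simp add: length_remdups_card_conv card_cartesian_product r_def)
    qed
    have "length (remdups Sa) \<le> 2 * r" "length (remdups Sb) \<le> 2 * r"
      using SR by (auto intro!: len simp: image_Un)
    then have "real ?n + 2 \<le> 4 * (real r + 2)" by simp
    then have "log 2 (real ?n + 2) \<le> log 2 (4 * (real r + 2))" by (subst log_le_cancel_iff) auto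
    also have "\<dots> = 2 + ?l" using log_mult[of 2 4 "real r + 2"] log_pow_cancel[of 2 2] by simp
    also have "\<dots> \<le> 3 * ?l" using log_ge_1[of r] by linarith
    finally have l1: "log 2 (real ?n + 2) \<le> 3 * ?l" .
    have "log 2 (real (2 * r + 2)) \<le> log 2 (2 * (real r + 2))" by (subst log_le_cancel_iff) auto
    also have "\<dots> = 1 + ?l" using log_mult[of 2 2 "real r + 2"] by simp
    finally have "real L \<le> 3 + ?l" using log_ge_1[of r] unfolding L_def by linarith
    then have l2: "real L \<le> 4 * ?l" using log_ge_1[of r] by linarith
    have k: "real ?k \<le> c * (3 * ?l)"
    proof -
      have "0 \<le> c * log 2 (real ?n + 2)"
        using c order_trans[OF zero_le_one log_ge_1] by (rule mult_nonneg_nonneg)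
      then have "real ?k \<le> c * log 2 (real ?n + 2)" by (rule of_nat_floor)
      also have "\<dots> \<le> c * (3 * ?l)" using l1 c by (intro mult_left_mono) auto
      finally show ?thesis .
    qed
    \<comment> \<open>The factor 12 is 4 times 3: at most \<open>4 * ?l\<close> bits per message, at
      most \<open>3 * c * ?l\<close> messages.\<close>
    have "real (L * ?k) \<le> (4 * ?l) * (c * (3 * ?l))"
      unfolding of_nat_mult by (intro mult_mono l2 k) simp_all
    also have "\<dots> = 12 * c * ?l ^ 2" by (simp add: power2_eq_square)
    finally have "real (L * ?k) \<le> 12 * c * ?l ^ 2" .
    moreover have "nx (mrun nx sy Sa Sb ?k) = Output (realizable H (Sa @ Sb))"
      using halts[of Sa Sb] unfolding run T_def by (simp add: nxt_def nx_def)
    ultimately show "\<exists>k. real (L * k) \<le> 12 * c * (log 2 (real (card R) + 2)) ^ 2 \<and>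
      nx (mrun nx sy Sa Sb k) = Output (realizable H (Sa @ Sb))" unfolding r_def by blast
  qed
  moreover have "bits_only (compile nx sy enc L M)"
    unfolding bits_only_def
  proof (intro allI)
    fix p and S :: "'x sample" and t :: "'x msg list"
    let ?m = "sy p S (decode enc L M t)"
    show "\<exists>b. say (compile nx sy enc L M) p S t = MBit b"
    proof (cases "?m \<in> M")
      case True
      then have "length t mod L < length (e ?m)" using length_enc[OF True] L_pos by (simp add: enc_def)
      then show ?thesis using True by (simp add: say_def compile_def Let_def enc_def)
    next
      case False
      then have "say (compile nx sy enc L M) p S t = MBit False"
        by (simp add: say_def compile_def Let_def)
      then show ?thesis ..
    qed
  qed
  ultimately show ?thesis by blast
qed

subsection \<open>The boosting protocol\<close>

definition mistakes :: "('x \<Rightarrow> bool) list \<Rightarrow> 'x example \<Rightarrow> nat" where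
  "mistakes hs z = length (filter (\<lambda>h. z \<in> err h) hs)"

lemma mistakes_snoc: "mistakes (hs @ [h]) z = mistakes hs z + of_bool (z \<in> err h)"
  by (simp add: mistakes_def)

definition weight :: "('x \<Rightarrow> bool) list \<Rightarrow> 'x example set \<Rightarrow> nat" where
  "weight hs A = (\<Sum>z\<in>A. 2 ^ mistakes hs z)"

lemma weight_snoc:
  assumes "finite A"
  shows "weight (hs @ [h]) A = weight hs A + weight hs (A \<inter> err h)"
proof -
  have "weight (hs @ [h]) A = (\<Sum>z\<in>A. 2 ^ mistakes hs z + (if z \<in> err h then 2 ^ mistakes hs z else 0))"
    unfolding weight_def by (rule sum.cong) (auto simp: mistakes_snoc)
  then show ?thesis using assms by (simp add: weight_def sum.distrib sum.inter_restrict)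
qed

text \<open>Weights are replaced by multiplicities, so that the unweighted net theorem applies.\<close>
lemma weighted_net:
  fixes H :: "('x \<Rightarrow> bool) set"
  assumes "vc_less (err ` H) d"
  shows "\<exists>s. \<forall>(S :: 'x sample) hs. \<exists>N. length N \<le> s \<and> set N \<subseteq> set S \<and>
    (\<forall>h\<in>H. err h \<inter> set N = {} \<longrightarrow> q * weight hs (set S \<inter> err h) \<le> weight hs (set S))"
proof -
  obtain s where s: "\<forall>(I :: ('x example \<times> nat) set) f. finite I \<longrightarrow> (\<exists>N\<subseteq>I. card N \<le> s \<and>
     (\<forall>A\<in>err ` H. card I < q * card {i\<in>I. f i \<in> A} \<longrightarrow> (\<exists>i\<in>N. f i \<in> A)))"
    using epsilon_net[OF assms, of q] by (rule exE)
  have "\<exists>N. length N \<le> s \<and> set N \<subseteq> set S \<and>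
    (\<forall>h\<in>H. err h \<inter> set N = {} \<longrightarrow> q * weight hs (set S \<inter> err h) \<le> weight hs (set S))"
    for S :: "'x sample" and hs
  proof -
    define I where "I A = Sigma A (\<lambda>z. {..<2 ^ mistakes hs z :: nat})" for A
    have cI: "card (I A) = weight hs A" if "finite A" for A
      using that by (simp add: I_def weight_def)
    have finI: "finite (I (set S))" by (simp add: I_def)
    obtain N where N: "N \<subseteq> I (set S)" "card N \<le> s"
      "\<forall>A\<in>err ` H. card (I (set S)) < q * card {i \<in> I (set S). fst i \<in> A} \<longrightarrow> (\<exists>i\<in>N. fst i \<in> A)"
      using mp[OF spec[OF spec[OF s, of "I (set S)"], of fst] finI] by (elim exE conjE)
    have finN: "finite N" using N(1) finI by (rule finite_subset)
    obtain L where L: "set L = fst ` N" "distinct L"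
      using finite_distinct_list[OF finite_imageI[OF finN, of fst]] by (elim exE conjE)
    have "length L \<le> s"
      using N(2) card_image_le[OF finN, of fst] distinct_card[OF L(2)] unfolding L(1) by linarith
    moreover have "set L \<subseteq> set S" using N(1) unfolding L(1) by (auto simp: I_def)
    moreover have "q * weight hs (set S \<inter> err h) \<le> weight hs (set S)"
      if h: "h \<in> H" and disj: "err h \<inter> set L = {}" for h
    proof -
      have "{i \<in> I (set S). fst i \<in> err h} = I (set S \<inter> err h)" by (auto simp: I_def)
      moreover have "\<not> (\<exists>i\<in>N. fst i \<in> err h)" using disj unfolding L(1) by blast
      ultimately have "\<not> card (I (set S)) < q * card (I (set S \<inter> err h))" using bspec[OF N(3) imageI[OF h]] by metis
      then show ?thesis by (simp add: cI)
    qed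
    ultimately show ?thesis by (intro exI[of _ L] conjI ballI impI)
  qed
  then show ?thesis by (intro exI[of _ s] allI)
qed

text \<open>The nets have \<open>\<epsilon> = 1 / (4 * k)\<close>: total weight then grows slowly
  enough to keep the mistakes on each example below a \<open>1 / k\<close> fraction.\<close>

locale boosting =
  fixes H :: "('x \<Rightarrow> bool) set" and k s :: nat
    and net :: "'x sample \<Rightarrow> ('x \<Rightarrow> bool) list \<Rightarrow> 'x sample"
  assumes k_pos: "k > 0" and covc: "covc_le H k"
    and length_net: "length (net S hs) \<le> s"
    and net_subset: "set (net S hs) \<subseteq> set S"
    and net: "h \<in> H \<Longrightarrow> err h \<inter> set (net S hs) = {} \<Longrightarrow> 4 * k * weight hs (set S \<inter> err h) \<le> weight hs (set S)"
begin

text \<open>Keeps from the joint history what one party's weights depend on: each hypothesis agrees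
  with that party's net at the time. The weight analysis thus applies to each party
  separately.\<close>

inductive good :: "'x sample \<Rightarrow> ('x \<Rightarrow> bool) list \<Rightarrow> bool" for S where
  Nil: "good S []"
| snoc: "good S hs \<Longrightarrow> h \<in> H \<Longrightarrow> err h \<inter> set (net S hs) = {} \<Longrightarrow> good S (hs @ [h])"

text \<open>Strict, since \<open>satisfied_imp_realizes\<close> sums it over at most
  \<open>k\<close> examples to get a contradiction; with no hypotheses yet, only the empty sample
  passes.\<close>

definition satisfied :: "'x sample \<Rightarrow> ('x \<Rightarrow> bool) list \<Rightarrow> bool" where
  "satisfied S hs \<longleftrightarrow> (\<forall>z\<in>set S. k * mistakes hs z < length hs)"

lemma good_subset: "good S hs \<Longrightarrow> set hs \<subseteq> H"
  by (induction rule: good.induct) auto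

text \<open>A hypothesis correct on the net errs on at most a \<open>1 / (4 * k)\<close> fraction of
  the weight, and only that part is doubled.\<close>

lemma weight_bound: "good S hs \<Longrightarrow> real (weight hs (set S)) \<le> card (set S) * (1 + 1 / (4 * k)) ^ length hs"
proof (induction rule: good.induct)
  case Nil
  then show ?case by (simp add: weight_def mistakes_def)
next
  case (snoc hs h)
  have "real (4 * k * weight hs (set S \<inter> err h)) \<le> real (weight hs (set S))"
    using net[OF snoc(2,3)] by (simp only: of_nat_le_iff)
  then have "real (weight hs (set S \<inter> err h)) \<le> real (weight hs (set S)) / (4 * k)"
    using k_pos by (simp add: field_simps)
  then have "real (weight (hs @ [h]) (set S)) \<le> real (weight hs (set S)) * (1 + 1 / (4 * k))"
    by (simp add: weight_snoc algebra_simps)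
  also have "\<dots> \<le> (card (set S) * (1 + 1 / (4 * k)) ^ length hs) * (1 + 1 / (4 * k))"
    using snoc.IH by (intro mult_right_mono) auto
  finally show ?case by (simp add: mult_ac)
qed

text \<open>An example with \<open>e\<close> mistakes alone weighs \<open>2 ^ e\<close>, so the
  bound on the total gives \<open>e \<le> log 2 (length S + 2) + length hs / (2 * k)\<close>; by
  \<open>len\<close> the first term is below \<open>length hs / (2 * k)\<close> as well.\<close>

lemma good_imp_satisfied:
  assumes good: "good S hs" and len: "2 * k * log 2 (real (length S) + 2) < length hs"
  shows "satisfied S hs"
  unfolding satisfied_def
proof
  fix z assume z: "z \<in> set S"
  \<comment> \<open>\<open>1 + x \<le> exp x \<le> 2 powr (2 * x)\<close> for
    \<open>x = 1 / (4 * k)\<close>, since \<open>ln 2 \<ge> 1 / 2\<close>.\<close>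
  have "1 + 1 / (4 * real k) \<le> exp (1 / (4 * real k))" by (rule exp_ge_add_one_self)
  also have "\<dots> \<le> 2 powr (1 / (2 * real k))"
  proof -
    have "1 / 2 \<le> ln (2 :: real)" using exp_half_le2 by (subst ln_ge_iff) auto
    then have "1 / (2 * real k) * (1 / 2) \<le> 1 / (2 * real k) * ln 2" by (intro mult_left_mono) auto
    then show ?thesis by (simp add: powr_def)
  qed
  finally have base: "1 + 1 / (4 * real k) \<le> 2 powr (1 / (2 * real k))" .
  have "(2::nat) ^ mistakes hs z \<le> weight hs (set S)"
    unfolding weight_def by (rule member_le_sum[OF z]) auto
  then have "real (2 ^ mistakes hs z) \<le> real (weight hs (set S))" by (rule of_nat_mono)
  also have "\<dots> \<le> card (set S) * (1 + 1 / (4 * k)) ^ length hs" by (rule weight_bound[OF good])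
  also have "\<dots> \<le> (real (length S) + 2) * (2 powr (1 / (2 * real k))) ^ length hs"
    using base card_length[of S] by (intro mult_mono power_mono) auto
  also have "\<dots> = 2 powr (log 2 (real (length S) + 2) + length hs / (2 * real k))"
    by (simp add: powr_add powr_powr flip: powr_realpow)
  finally have "2 powr real (mistakes hs z) \<le> 2 powr (log 2 (real (length S) + 2) + length hs / (2 * real k))"
    by (simp add: powr_realpow)
  then have "real (mistakes hs z) \<le> log 2 (real (length S) + 2) + length hs / (2 * real k)" by simp
  then have "real k * real (mistakes hs z) \<le> real k * (log 2 (real (length S) + 2) + length hs / (2 * real k))"
    by (rule mult_left_mono) simp
  also have "\<dots> = real k * log 2 (real (length S) + 2) + length hs / 2"
    using k_pos by (simp add: field_simps)
  also have "\<dots> < length hs" using len by simp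
  finally show "k * mistakes hs z < length hs" by (simp flip: of_nat_mult)
qed

text \<open>A small unrealizable subsample would be misclassified somewhere by every hypothesis, so one of
  its at most \<open>k\<close> points would collect a fraction of at least \<open>1/k\<close> of the mistakes.\<close>
lemma satisfied_imp_realizes:
  assumes H: "H \<noteq> {}" and hs: "set hs \<subseteq> H" and sat: "satisfied Sa hs" "satisfied Sb hs"
  shows "realizes H (set Sa \<union> set Sb)"
proof (rule ccontr)
  assume "\<not> realizes H (set Sa \<union> set Sb)"
  then obtain A where A: "A \<subseteq> set Sa \<union> set Sb" "card A \<le> k" "\<not> realizes H A"
    using covc unfolding covc_le_def
    by (elim allE[of _ "set Sa \<union> set Sb"]) auto
  have finA: "finite A" using A(1) finite_subset by blast
  have A0: "A \<noteq> {}" using A(3) H by (auto simp: realizes_def)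
  have "length hs \<le> (\<Sum>z\<in>A. mistakes hs z)"
    using hs
  proof (induction hs rule: rev_induct)
    case (snoc h hs)
    then have "err h \<inter> A \<noteq> {}" using A(3) by (auto simp: realizes_def)
    then obtain z where z: "z \<in> A" "z \<in> err h" by blast
    have "(1::nat) \<le> (\<Sum>z\<in>A. of_bool (z \<in> err h))"
      using member_le_sum[of z A "\<lambda>z. of_bool (z \<in> err h) :: nat"] z finA by simp
    then show ?case using snoc by (simp add: mistakes_snoc sum.distrib)
  qed simp
  then have "k * length hs \<le> (\<Sum>z\<in>A. k * mistakes hs z)" by (simp add: sum_distrib_left[symmetric])
  also have "\<dots> < (\<Sum>z\<in>A. length hs)"
    using A(1) sat by (intro sum_strict_mono finA A0) (auto simp: satisfied_def)
  also have "\<dots> \<le> k * length hs" using A(2) by simp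
  finally show False by simp
qed

text \<open>A fixed choice determined by the two nets, so both parties know the next hypothesis
  without sending it.\<close>

definition pick :: "'x sample \<Rightarrow> 'x sample \<Rightarrow> 'x \<Rightarrow> bool" where
  "pick N N' = (SOME h. h \<in> H \<and> err h \<inter> (set N \<union> set N') = {})"

lemma pick: "realizes H (set N \<union> set N') \<Longrightarrow> pick N N' \<in> H \<and> err (pick N N') \<inter> (set N \<union> set N') = {}"
  using someI_ex[of "\<lambda>h. h \<in> H \<and> err h \<inter> (set N \<union> set N') = {}"]
  unfolding pick_def realizes_def Bex_def by simp

text \<open>A round is a message of Alice followed by one of Bob, each consisting of the flag \<open>satisfied\<close> and a
  net; an incomplete last round contributes no hypothesis.\<close>
fun hyps :: "(bool \<times> 'x sample) list \<Rightarrow> ('x \<Rightarrow> bool) list" where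
  "hyps (a # b # ms) = pick (snd a) (snd b) # hyps ms"
| "hyps _ = []"

lemma hyps_append: "even (length ms) \<Longrightarrow> hyps (ms @ ns) = hyps ms @ hyps ns"
  by (induction ms rule: hyps.induct) auto

text \<open>Verdicts come only after complete rounds. The flags concern the hypotheses before the
  round, and \<open>Output True\<close> also relies on the nets being realizable, which excludes an
  empty \<open>H\<close>.\<close>

definition nx :: "(bool \<times> 'x sample) list \<Rightarrow> step" where
  "nx ms =
    (if odd (length ms) then Turn False else if ms = [] then Turn True else
     let a = ms ! (length ms - 2); b = ms ! (length ms - 1) in
       if \<not> realizes H (set (snd a) \<union> set (snd b)) then Output False
       else if fst a \<and> fst b then Output True else Turn True)"

definition sy :: "bool \<Rightarrow> 'x sample \<Rightarrow> (bool \<times> 'x sample) list \<Rightarrow> bool \<times> 'x sample" where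
  "sy p S ms = (satisfied S (hyps ms), net S (hyps ms))"

text \<open>The round invariant. \<open>butlast\<close> appears because the flags of the last round
  were computed before its hypothesis was added.\<close>

lemma rounds:
  fixes Sa Sb :: "'x sample" and j :: nat
  defines "ms \<equiv> mrun nx sy Sa Sb (2 * j)"
  shows "nx ms = Output (realizable H (Sa @ Sb)) \<or>
    nx ms = Turn True \<and> length (hyps ms) = j \<and> even (length ms) \<and> good Sa (hyps ms) \<and> good Sb (hyps ms)
      \<and> (j > 0 \<longrightarrow> \<not> (satisfied Sa (butlast (hyps ms)) \<and> satisfied Sb (butlast (hyps ms))))"
  unfolding ms_def
proof (induction j)
  case 0
  show ?case by (simp add: nx_def good.Nil)
next
  case (Suc j)
  define ms where "ms = mrun nx sy Sa Sb (2 * j)"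
  define ms' where "ms' = mrun nx sy Sa Sb (2 * Suc j)"
  have step: "ms' = (case nx ms of Output b \<Rightarrow> ms | Turn p \<Rightarrow>
      let t = ms @ [sy p (if p then Sa else Sb) ms] in
        case nx t of Output b \<Rightarrow> t | Turn p \<Rightarrow> t @ [sy p (if p then Sa else Sb) t])"
    by (simp add: ms_def ms'_def Let_def split: step.splits)
  consider "nx ms = Output (realizable H (Sa @ Sb))" | "nx ms = Turn True" "length (hyps ms) = j"
    "even (length ms)" "good Sa (hyps ms)" "good Sb (hyps ms)"
    using Suc.IH unfolding ms_def by blast
  then show ?case
  proof cases
    case 1
    then have "ms' = ms" using step by simp
    then show ?thesis using 1 unfolding ms'_def[symmetric] by simp
  next
    case 2
    define hs where "hs = hyps ms"
    let ?na = "net Sa hs" and ?nb = "net Sb hs"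
    let ?a = "(satisfied Sa hs, ?na)" and ?b = "(satisfied Sb hs, ?nb)"
    have "hyps (ms @ [?a]) = hs" using 2(3) by (simp add: hyps_append hs_def)
    moreover have "nx (ms @ [?a]) = Turn False" using 2(3) by (simp add: nx_def)
    ultimately have ms': "ms' = ms @ [?a, ?b]"
      unfolding step 2(1) by (simp add: sy_def Let_def hs_def)
    have hyps': "hyps ms' = hs @ [pick ?na ?nb]" using 2(3) by (simp add: ms' hyps_append hs_def)
    have nx': "nx ms' = (if \<not> realizes H (set ?na \<union> set ?nb) then Output False
       else if satisfied Sa hs \<and> satisfied Sb hs then Output True else Turn True)"
      using 2(3) by (simp add: nx_def ms' nth_append)
    have real: "realizable H (Sa @ Sb) \<longleftrightarrow> realizes H (set Sa \<union> set Sb)" by (simp add: realizable_iff)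
    show ?thesis
    proof (cases "realizes H (set ?na \<union> set ?nb)")
      case False
      have "\<not> realizable H (Sa @ Sb)"
        unfolding real using False realizes_mono[OF _ Un_mono[OF net_subset net_subset]] by (rule contrapos_nn)
      then show ?thesis using nx' False unfolding ms'_def[symmetric] by simp
    next
      case True
      have H: "H \<noteq> {}" using True by (auto simp: realizes_def)
      show ?thesis
      proof (cases "satisfied Sa hs \<and> satisfied Sb hs")
        case sat: True
        have "set hs \<subseteq> H" using good_subset 2(4) by (simp add: hs_def)
        then have "realizable H (Sa @ Sb)" using satisfied_imp_realizes[OF H] sat unfolding real by simp
        then show ?thesis using nx' True sat unfolding ms'_def[symmetric] by simp
      next
        case False
        have "good Sa (hyps ms')" "good Sb (hyps ms')"
          using 2(4,5) pick[OF True] unfolding hyps' hs_def by (auto intro!: good.snoc)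
        moreover have "nx ms' = Turn True" unfolding nx' using True False by auto
        moreover have "length (hyps ms') = Suc j" "even (length ms')" "butlast (hyps ms') = hs"
          using 2(2,3) unfolding hyps' by (simp_all add: ms' hs_def)
        ultimately show ?thesis using False unfolding ms'_def[symmetric] by simp
      qed
    qed
  qed
qed

lemma halts:
  fixes Sa Sb :: "'x sample"
  shows "\<exists>j. real j \<le> (2 * k + 2) * log 2 (real (length Sa + length Sb) + 2) \<and>
    nx (mrun nx sy Sa Sb (2 * j)) = Output (realizable H (Sa @ Sb))"
proof -
  let ?l = "log 2 (real (length Sa + length Sb) + 2)"
  \<comment> \<open>After \<open>T\<close> hypotheses both parties are satisfied; the next round
    announces it, hence \<open>T + 1\<close> rounds.\<close>
  define T where "T = nat \<lfloor>2 * k * ?l\<rfloor> + 1"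
  have l: "1 \<le> ?l" by (rule log_ge_1)
  have nonneg: "0 \<le> 2 * k * ?l" using l by (intro mult_nonneg_nonneg) auto
  have T: "2 * k * ?l < T" unfolding T_def by linarith
  have "real (T + 1) \<le> 2 * k * ?l + 2" unfolding T_def using of_nat_floor[OF nonneg] by simp
  also have "\<dots> \<le> (2 * k + 2) * ?l" using l by (simp add: algebra_simps)
  finally have bound: "real (T + 1) \<le> (2 * k + 2) * ?l" .
  define ms where "ms = mrun nx sy Sa Sb (2 * (T + 1))"
  have "nx ms = Output (realizable H (Sa @ Sb))"
  proof (rule ccontr)
    assume "nx ms \<noteq> Output (realizable H (Sa @ Sb))"
    then have ms: "length (hyps ms) = T + 1" "good Sa (hyps ms)" "good Sb (hyps ms)"
      "\<not> (satisfied Sa (butlast (hyps ms)) \<and> satisfied Sb (butlast (hyps ms)))"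
      using rounds[where j = "T + 1" and Sa = Sa and Sb = Sb] unfolding ms_def by auto
    have good: "good S (butlast hs)" if "good S hs" for S hs
      using that by (cases rule: good.cases) (auto intro: good.Nil)
    have sat: "satisfied S (butlast (hyps ms))" if "good S (hyps ms)" "length S \<le> length Sa + length Sb" for S
    proof (rule good_imp_satisfied[OF good[OF that(1)]])
      have "log 2 (real (length S) + 2) \<le> ?l" using that(2) by (subst log_le_cancel_iff) auto
      then have "2 * k * log 2 (real (length S) + 2) \<le> 2 * k * ?l" by (rule mult_left_mono) simp
      also note T
      finally show "2 * k * log 2 (real (length S) + 2) < length (butlast (hyps ms))" using ms(1) by simp
    qed
    show False using sat[OF ms(2)] sat[OF ms(3)] ms(4) by simp
  qed
  then show ?thesis using bound unfolding ms_def by blast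
qed

text \<open>Shorter nets are padded with bits to length \<open>s\<close>: a party with an empty sample has no example to send.\<close>
definition enc :: "bool \<times> 'x sample \<Rightarrow> 'x msg list" where
  "enc m = MBit (fst m) # map MEx (snd m) @ replicate (s - length (snd m)) (MBit False)"

lemma enc_block_code: "block_code enc (s + 1) {m. length (snd m) \<le> s}"
proof
  define examples :: "'x msg list \<Rightarrow> 'x sample" where
    "examples = (\<lambda>t. concat (map (\<lambda>m. case m of MBit _ \<Rightarrow> [] | MEx z \<Rightarrow> [z]) t))"
  have bits: "examples (map MEx N @ replicate i (MBit False)) = N" for N i
    by (induction N) (induction i, auto simp: examples_def)
  show "inj_on enc {m. length (snd m) \<le> s}"
  proof (rule inj_onI)
    fix m m' assume "enc m = enc m'"
    then have "fst m = fst m'" and "map MEx (snd m) @ replicate (s - length (snd m)) (MBit False) =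
        map MEx (snd m') @ replicate (s - length (snd m')) (MBit False)"
      by (simp_all add: enc_def)
    from arg_cong[OF this(2), of examples] this(1) show "m = m'" by (simp add: bits prod_eq_iff)
  qed
qed (auto simp: enc_def)

text \<open>A round costs two blocks of \<open>s + 1\<close> units, and \<open>halts\<close> bounds
  the number of rounds.\<close>

lemma decides:
  "decides_within (compile nx sy enc (s + 1) {m. length (snd m) \<le> s}) H UNIV
     (\<lambda>n. 2 * (s + 1) * (2 * k + 2) * log 2 (real n + 2))"
proof -
  interpret block_code enc "s + 1" "{m. length (snd m) \<le> s}" by (rule enc_block_code)
  show ?thesis
  proof (rule decides_compile)
    fix p S ms z assume "MEx z \<in> set (enc (sy p S ms))"
    then show "z \<in> set S" using net_subset by (auto simp: enc_def sy_def)
  next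
    fix Sa Sb :: "'x sample"
    obtain j where j: "real j \<le> (2 * k + 2) * log 2 (real (length Sa + length Sb) + 2)"
      "nx (mrun nx sy Sa Sb (2 * j)) = Output (realizable H (Sa @ Sb))" using halts by blast
    have "real ((s + 1) * (2 * j)) = 2 * (s + 1) * real j" by (simp add: algebra_simps)
    also have "\<dots> \<le> 2 * (s + 1) * ((2 * k + 2) * log 2 (real (length Sa + length Sb) + 2))"
      using j(1) by (rule mult_left_mono) simp
    finally have "real ((s + 1) * (2 * j)) \<le> 2 * (s + 1) * (2 * k + 2) * log 2 (real (length Sa + length Sb) + 2)"
      by (simp only: of_nat_mult mult.assoc)
    then show "\<exists>i. real ((s + 1) * i) \<le> 2 * (s + 1) * (2 * k + 2) * log 2 (real (length Sa + length Sb) + 2) \<and>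
      nx (mrun nx sy Sa Sb i) = Output (realizable H (Sa @ Sb))" using j(2) by blast
  qed (simp add: sy_def length_net)
qed

end

section \<open>Protocols from finite dimensions, and the equivalence\<close>

lemma finite_dimensions_imp_protocol:
  fixes H :: "('x \<Rightarrow> bool) set"
  assumes "vc_less (err ` H) d" "covc_le H k"
  shows "\<exists>P c. c \<ge> 0 \<and> decides_within P H UNIV (\<lambda>n. c * log 2 (real n + 2))"
proof -
  \<comment> \<open>Passing to \<open>k + 1\<close> provides the positive bound that boosting
    divides by.\<close>
  have covc: "covc_le H (k + 1)"
    unfolding covc_le_def
  proof (intro allI impI)
    fix A :: "'x example set" assume "finite A" "\<not> realizes H A"
    then obtain A' where "A' \<subseteq> A" "card A' \<le> k" "\<not> realizes H A'" using assms(2) by (auto simp: covc_le_def)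
    then show "\<exists>A'\<subseteq>A. card A' \<le> k + 1 \<and> \<not> realizes H A'" by (intro exI[of _ A']) simp
  qed
  obtain s where s: "\<forall>(S :: 'x sample) hs. \<exists>N. length N \<le> s \<and> set N \<subseteq> set S \<and>
    (\<forall>h\<in>H. err h \<inter> set N = {} \<longrightarrow> 4 * (k + 1) * weight hs (set S \<inter> err h) \<le> weight hs (set S))"
    using weighted_net[OF assms(1), of "4 * (k + 1)"] by (rule exE)
  obtain net where net: "\<forall>(S :: 'x sample) hs. length (net S hs) \<le> s \<and> set (net S hs) \<subseteq> set S \<and>
    (\<forall>h\<in>H. err h \<inter> set (net S hs) = {} \<longrightarrow> 4 * (k + 1) * weight hs (set S \<inter> err h) \<le> weight hs (set S))"
    using s unfolding choice_iff by (elim exE)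
  interpret boosting H "k + 1" s net
    by unfold_locales (use covc net in simp_all)
  have "0 \<le> real (2 * (s + 1) * (2 * (k + 1) + 2))" by (rule of_nat_0_le_iff)
  then show ?thesis using decides by (intro exI conjI)
qed

theorem theorem9:
  fixes H :: "('x \<Rightarrow> bool) set"
  shows "(in_P H \<longleftrightarrow>
           (\<exists>c::real. \<forall>R. finite R \<longrightarrow>
              (\<exists>P. decides_within P H R (\<lambda>n. c * log 2 (real n + 2)))))
       \<and> ((\<exists>c::real. \<forall>R. finite R \<longrightarrow>
              (\<exists>P. decides_within P H R (\<lambda>n. c * log 2 (real n + 2))))
          \<longleftrightarrow>
          (\<exists>(c::real) (m::nat). \<forall>R. finite R \<longrightarrow>
              (\<exists>P. bits_only P \<and>
                   decides_within P H R (\<lambda>_. c * (log 2 (real (card R) + 2)) ^ m))))"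
    (is "(in_P H \<longleftrightarrow> ?ii) \<and> (?ii \<longleftrightarrow> ?iii)")
proof -
  \<comment> \<open>The hub of the equivalence: each condition implies \<open>?fin\<close>, and
    \<open>?fin\<close> implies them all.\<close>
  let ?fin = "(\<exists>d. vc_less (err ` H) d) \<and> (\<exists>k. covc_le H k)"
  have restrict: "decides_within P H R B" if "decides_within P H UNIV B" for P R B
    using that by (simp add: decides_within_def)
  \<comment> \<open>The constants in the conditions may be negative, while the lower bound takes a
    nonnegative one; hence \<open>\<bar>c\<bar>\<close>.\<close>
  have le: "c * l ^ m \<le> \<bar>c\<bar> * l' ^ m" if "0 \<le> l" "l \<le> l'" for c l l' :: real and m
    using that by (intro mult_mono power_mono) auto
  have "?fin" if i: "in_P H"
  proof -
    obtain P and c :: real and m where P: "decides_within P H UNIV (\<lambda>n. c * log 2 (real n + 2) ^ m)"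
      using i unfolding in_P_def by blast
    have "\<exists>P B. decides_within P H R B \<and> (\<forall>n\<ge>card R. B n \<le> \<bar>c\<bar> * log 2 (real n + 2) ^ m)" for R
      using restrict[OF P, of R] le[of "log 2 (real _ + 2)" "log 2 (real _ + 2)" c m]
      by (intro exI[of _ P] exI[of _ "\<lambda>n. c * log 2 (real n + 2) ^ m"]) simp
    then show ?thesis using protocols_imp_finite_dimensions[of H "\<bar>c\<bar>" m] by simp
  qed
  moreover have "?fin" if ii: ?ii
  proof -
    obtain c :: real where c: "\<And>R. finite R \<Longrightarrow> \<exists>P. decides_within P H R (\<lambda>n. c * log 2 (real n + 2))"
      using ii by blast
    have "\<exists>P B. decides_within P H R B \<and> (\<forall>n\<ge>card R. B n \<le> \<bar>c\<bar> * log 2 (real n + 2) ^ 1)" if R: "finite R" for R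
    proof -
      obtain P where "decides_within P H R (\<lambda>n. c * log 2 (real n + 2))" using c[OF R] by blast
      moreover have "c * log 2 (real n + 2) \<le> \<bar>c\<bar> * log 2 (real n + 2) ^ 1" for n
        using le[of "log 2 (real n + 2)" "log 2 (real n + 2)" c 1] by simp
      ultimately show ?thesis
        by (intro exI[of _ P] exI[of _ "\<lambda>n. c * log 2 (real n + 2)"]) simp
    qed
    then show ?thesis using protocols_imp_finite_dimensions[of H "\<bar>c\<bar>" 1] by simp
  qed
  moreover have "?fin" if iii: ?iii
  proof -
    obtain c :: real and m where c: "\<forall>R. finite R \<longrightarrow>
        (\<exists>P. bits_only P \<and> decides_within P H R (\<lambda>_. c * log 2 (real (card R) + 2) ^ m))"
      using iii by (elim exE)
    have "\<exists>P B. decides_within P H R B \<and> (\<forall>n\<ge>card R. B n \<le> \<bar>c\<bar> * log 2 (real n + 2) ^ m)" if R: "finite R" for R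
    proof -
      obtain P where "decides_within P H R (\<lambda>_. c * log 2 (real (card R) + 2) ^ m)" using c R by blast
      moreover have "c * log 2 (real (card R) + 2) ^ m \<le> \<bar>c\<bar> * log 2 (real n + 2) ^ m" if "card R \<le> n" for n
        using that by (intro le) auto
      ultimately show ?thesis
        by (intro exI[of _ P] exI[of _ "\<lambda>_. c * log 2 (real (card R) + 2) ^ m"]) simp
    qed
    then show ?thesis using protocols_imp_finite_dimensions[of H "\<bar>c\<bar>" m] by simp
  qed
  moreover have "in_P H \<and> ?ii \<and> ?iii" if fin: ?fin
  proof -
    obtain P c where c: "c \<ge> 0" and P: "decides_within P H UNIV (\<lambda>n. c * log 2 (real n + 2))"
      using fin finite_dimensions_imp_protocol by blast
    have "in_P H" unfolding in_P_def using P by (intro exI[of _ P] exI[of _ c] exI[of _ 1]) simp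
    moreover have ?ii using restrict[OF P] by (intro exI[of _ c] allI impI exI[of _ P])
    moreover have ?iii by (intro exI[of _ "12 * c"] exI[of _ 2] allI impI yao_simulation[OF P c])
    ultimately show ?thesis by blast
  qed
  ultimately show ?thesis by blast
qed

end
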